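(* Let $K$ be an algebraically closed field, let $G$ be a torsion group, and let $K_\rho G$ be a twisted group algebra of $G$ over $K$ with factor system $\rho$. Then $K_\rho G$ contains no nonzero nilpotent elements if and only if the following conditions all hold: (i) $G$ is an abelian group; (ii) the order of every element of $G$ is invertible in $K$; (iii) the factor system $\rho$ is symmetric.
   Context: Let $G$ be a group and $K$ a field. A twisted group algebra (twisted group ring) $K_\rho G$ of $G$ over $K$ is an associative $K$-algebra with a $K$-basis $\{u_g \mid g\in G\}$ indexed by $G$ (so scalars of $K$ commute with all $u_g$) and with multiplication determined by $u_g u_h=\rho(g,h)u_{gh}$ for $g,h\in G$, where $\rho=\{\rho(g,h)\mid g,h\in G\}$ is a family of nonzero elements of $K$ (the factor system) for which this multiplication is associative. The factor system is assumed normalized: $\rho(g,1)=\rho(1,g)=\rho(1,1)=1$ for all $g\in G$, so $u_1$ is the identity element. The factor system $\rho$ is called symmetric if for all $g,h\in G$ the condition $gh=hg$ implies $\rho(g,h)=\rho(h,g)$. A condition that the order of an element is invertible in $K$ means that this integer is nonzero in $K$. *)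

theory Defs
  imports "HOL-Algebra.Algebra"
begin

definition torsion_group :: "('g, 'm) monoid_scheme \<Rightarrow> bool" where
  "torsion_group G \<longleftrightarrow>
     group G \<and> (\<forall>g\<in>carrier G. \<exists>n::nat. n > 0 \<and> g [^]\<^bsub>G\<^esub> n = \<one>\<^bsub>G\<^esub>)"

definition nilpotent_element :: "('a, 'm) ring_scheme \<Rightarrow> 'a \<Rightarrow> bool" where
  "nilpotent_element A x \<longleftrightarrow>
     x \<in> carrier A \<and> (\<exists>n::nat. n > 0 \<and> x [^]\<^bsub>A\<^esub> n = \<zero>\<^bsub>A\<^esub>)"

text \<open>
  The library locale \<^locale>\<open>algebra\<close> demands a commutative algebra, hence the following variant.
\<close>

locale associative_algebra = module K A + A: ring A for K (structure) and A (structure) +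
  assumes smult_mult_left:
      "\<lbrakk>a \<in> carrier K; x \<in> carrier A; y \<in> carrier A\<rbrakk> \<Longrightarrow>
       (a \<odot>\<^bsub>A\<^esub> x) \<otimes>\<^bsub>A\<^esub> y = a \<odot>\<^bsub>A\<^esub> (x \<otimes>\<^bsub>A\<^esub> y)"
    and smult_mult_right:
      "\<lbrakk>a \<in> carrier K; x \<in> carrier A; y \<in> carrier A\<rbrakk> \<Longrightarrow>
       x \<otimes>\<^bsub>A\<^esub> (a \<odot>\<^bsub>A\<^esub> y) = a \<odot>\<^bsub>A\<^esub> (x \<otimes>\<^bsub>A\<^esub> y)"

text \<open>
  Linear independence is that of the family, not of its range, so the members of an independent
  family over a nonzero ring of scalars are pairwise distinct.
\<close>

definition independent_family ::
  "('k, 'm) ring_scheme \<Rightarrow> ('k, 'a, 'n) module_scheme \<Rightarrow> 'i set \<Rightarrow> ('i \<Rightarrow> 'a) \<Rightarrow> bool" where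
  "independent_family K A I u \<longleftrightarrow>
     (\<forall>F c. finite F \<and> F \<subseteq> I \<and> c \<in> F \<rightarrow> carrier K \<and>
        (\<Oplus>\<^bsub>A\<^esub>i\<in>F. c i \<odot>\<^bsub>A\<^esub> u i) = \<zero>\<^bsub>A\<^esub> \<longrightarrow> (\<forall>i\<in>F. c i = \<zero>\<^bsub>K\<^esub>))"

definition spanning_family ::
  "('k, 'm) ring_scheme \<Rightarrow> ('k, 'a, 'n) module_scheme \<Rightarrow> 'i set \<Rightarrow> ('i \<Rightarrow> 'a) \<Rightarrow> bool" where
  "spanning_family K A I u \<longleftrightarrow>
     (\<forall>x\<in>carrier A. \<exists>F c. finite F \<and> F \<subseteq> I \<and> c \<in> F \<rightarrow> carrier K \<and>
        x = (\<Oplus>\<^bsub>A\<^esub>i\<in>F. c i \<odot>\<^bsub>A\<^esub> u i))"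

definition basis_family ::
  "('k, 'm) ring_scheme \<Rightarrow> ('k, 'a, 'n) module_scheme \<Rightarrow> 'i set \<Rightarrow> ('i \<Rightarrow> 'a) \<Rightarrow> bool" where
  "basis_family K A I u \<longleftrightarrow>
     u \<in> I \<rightarrow> carrier A \<and> independent_family K A I u \<and> spanning_family K A I u"

text \<open>
  \<open>A\<close> is the twisted group algebra of \<open>G\<close> over \<open>K\<close> with factor system \<open>\<rho>\<close>, with respect to the
  basis \<open>u\<close>. These data determine \<open>A\<close> up to isomorphism. The 2-cocycle identity for \<open>\<rho>\<close> is not
  assumed separately: it is equivalent to the associativity of \<open>A\<close>, which is part of
  \<^locale>\<open>ring\<close>. Normalization of \<open>\<rho>\<close> makes \<open>u \<one>\<^bsub>G\<^esub>\<close> the identity of \<open>A\<close>.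
\<close>

locale twisted_group_algebra =
  K: field K + G: group G + associative_algebra K A
  for K :: "('k, 'm) ring_scheme" (structure)
    and G :: "('g, 'n) monoid_scheme" (structure)
    and \<rho> :: "'g \<Rightarrow> 'g \<Rightarrow> 'k"
    and A :: "('k, 'a, 'p) module_scheme" (structure)
    and u :: "'g \<Rightarrow> 'a" +
  assumes factor_nonzero:
      "\<lbrakk>g \<in> carrier G; h \<in> carrier G\<rbrakk> \<Longrightarrow> \<rho> g h \<in> carrier K - {\<zero>\<^bsub>K\<^esub>}"
    and factor_one_right: "g \<in> carrier G \<Longrightarrow> \<rho> g \<one>\<^bsub>G\<^esub> = \<one>\<^bsub>K\<^esub>"
    and factor_one_left: "g \<in> carrier G \<Longrightarrow> \<rho> \<one>\<^bsub>G\<^esub> g = \<one>\<^bsub>K\<^esub>"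
    and basis: "basis_family K A (carrier G) u"
    and basis_mult:
      "\<lbrakk>g \<in> carrier G; h \<in> carrier G\<rbrakk> \<Longrightarrow> u g \<otimes>\<^bsub>A\<^esub> u h = \<rho> g h \<odot>\<^bsub>A\<^esub> u (g \<otimes>\<^bsub>G\<^esub> h)"

definition symmetric_factor_system ::
  "('g, 'n) monoid_scheme \<Rightarrow> ('g \<Rightarrow> 'g \<Rightarrow> 'k) \<Rightarrow> bool" where
  "symmetric_factor_system G \<rho> \<longleftrightarrow>
     (\<forall>g\<in>carrier G. \<forall>h\<in>carrier G. g \<otimes>\<^bsub>G\<^esub> h = h \<otimes>\<^bsub>G\<^esub> g \<longrightarrow> \<rho> g h = \<rho> h g)"

end

theory Submission
  imports Defs
begin

text \<open>
  Suppose first that zero is the only nilpotent element. Let \<open>g\<close> have order \<open>n\<close>. Then \<open>(u g)\<^sup>n\<close> is a nonzero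
  scalar, and as \<open>K\<close> is algebraically closed some multiple \<open>s\<close> of \<open>u g\<close> satisfies \<open>s\<^sup>n = 1\<close>. The sum
  \<open>N\<close> of the \<open>n\<close> distinct powers of \<open>s\<close> satisfies \<open>N\<^sup>2 = n N\<close>. It is nonzero by linear independence, so \<open>n\<close> does not vanish in \<open>K\<close>
  (\<open>reduced_imp_ord_invertible\<close>). Hence \<open>s\<close> is a linear combination of idempotents, its spectral projections,
  and idempotents of a reduced ring are central; so \<open>s\<close> and \<open>u g\<close> are central
  (\<open>reduced_periodic_central\<close>). Comparing \<open>u g u h\<close> with \<open>u h u g\<close> yields that \<open>G\<close> is abelian and \<open>\<rho>\<close>
  symmetric.

  Conversely, \<open>A\<close> is commutative if \<open>G\<close> is abelian and \<open>\<rho>\<close> symmetric. It then suffices that every nilpotent element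
  has coefficient zero at \<open>\<one>\<close>, since a nilpotent element can be multiplied by any \<open>u g\<close>
  (\<open>nilpotent_imp_zero\<close>). This is proved for the elements supported on a subgroup \<open>H\<close>, where \<open>H\<close> is
  enlarged by one generator \<open>g\<close> at a time. The quotient of the enlarged group \<open>L\<close> by \<open>H\<close> is cyclic of an
  invertible order \<open>m\<close>. A character of \<open>L\<close> with kernel \<open>H\<close> acts on the algebra of \<open>L\<close> by automorphisms, and the
  sum of the conjugates of an element under its powers is \<open>m\<close> times the part supported on \<open>H\<close>. As a
  sum of commuting nilpotent elements that part is nilpotent, and the claim for \<open>L\<close> follows from the claim for
  \<open>H\<close> (\<open>nilpotents_traceless_on_adjoin\<close>). Zorn's lemma then reaches \<open>G\<close>.
\<close>

section \<open>Finite products and geometric sums\<close>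

lemma (in comm_monoid) finprod_swap:
  assumes "finite I" "finite J" "\<And>i j. i \<in> I \<Longrightarrow> j \<in> J \<Longrightarrow> f i j \<in> carrier G"
  shows "(\<Otimes>i\<in>I. \<Otimes>j\<in>J. f i j) = (\<Otimes>j\<in>J. \<Otimes>i\<in>I. f i j)"
  using assms(1,3)
proof (induction I rule: finite_induct)
  case empty
  then show ?case by simp
next
  case (insert i I)
  then have "(\<Otimes>i\<in>insert i I. \<Otimes>j\<in>J. f i j) = (\<Otimes>j\<in>J. f i j \<otimes> (\<Otimes>i\<in>I. f i j))"
    by (simp add: finprod_multf Pi_def)
  also have "\<dots> = (\<Otimes>j\<in>J. \<Otimes>i\<in>insert i I. f i j)"
    using insert by (intro finprod_cong') auto
  finally show ?case .
qed

lemmas (in abelian_monoid) finsum_swap = add.finprod_swap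

lemma (in ring) geometric_sum_shift:
  assumes "s \<in> carrier R"
  shows "s \<otimes> (\<Oplus>j\<in>{..<n}. s [^] j) \<oplus> \<one> = (\<Oplus>j\<in>{..<n}. s [^] j) \<oplus> s [^] (n::nat)"
proof (induction n)
  case 0
  then show ?case using assms by simp
next
  case (Suc n)
  let ?S = "\<Oplus>j\<in>{..<n}. s [^] j"
  have S: "?S \<in> carrier R" using assms by (simp add: Pi_def)
  have step: "(\<Oplus>j\<in>{..<Suc n}. s [^] j) = s [^] n \<oplus> ?S"
    using assms by (simp add: lessThan_Suc finsum_insert Pi_def)
  have "s \<otimes> (s [^] n \<oplus> ?S) \<oplus> \<one> = s \<otimes> s [^] n \<oplus> (s \<otimes> ?S \<oplus> \<one>)"
    using assms S by (simp add: r_distr a_assoc)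
  also have "\<dots> = s [^] Suc n \<oplus> (?S \<oplus> s [^] n)"
    unfolding Suc.IH using nat_pow_Suc2[OF assms, of n] by simp
  finally show ?case
    unfolding step using assms S by (simp add: a_ac)
qed

section \<open>Roots of unity in an algebraically closed field\<close>

context algebraically_closed begin

lemma root_exists:
  assumes "set p \<subseteq> carrier L" "p \<noteq> []" "lead_coeff p \<noteq> \<zero>" "degree p > 0"
  obtains x where "x \<in> carrier L" "eval p x = \<zero>"
proof -
  have p: "p \<in> carrier (poly_ring L)"
    using assms by (simp add: polynomial_def flip: univ_poly_carrier)
  then have "size (roots p) > 0"
    using roots_over_carrier[OF p] assms(4) by (simp add: splitted_def)
  then obtain x where "x \<in># roots p"
    by (metis size_empty less_irrefl multiset_nonemptyE)
  then show thesis
    using that roots_mem_iff_is_root[OF p] by (auto simp: is_root_def)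
qed

lemma nth_root_exists:
  assumes "c \<in> carrier L" "n > 0"
  obtains d where "d \<in> carrier L" "d [^] (n::nat) = c"
proof -
  define p where "p = monom \<one> (n - 1) @ [\<ominus> c]"
  have "degree p = n" "lead_coeff p = \<one>" "p \<noteq> []" "set p \<subseteq> carrier L"
    using assms by (auto simp: p_def monom_def)
  then obtain d where d: "d \<in> carrier L" "eval p d = \<zero>"
    using root_exists[of p] assms(2) by auto
  have "eval p d = (d [^] (n - 1)) \<otimes> d \<ominus> c"
    unfolding p_def
    using d(1) assms eval_monom[of \<one> d "n - 1"]
    by (subst eval_append_aux) (auto simp: minus_eq intro: monom_in_carrier[THEN subsetD])
  also have "\<dots> = d [^] n \<ominus> c"
    using assms(2) d(1) nat_pow_Suc[of d "n - 1"] by simp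
  finally show thesis
    using that[OF d(1)] d assms minus_eq[of "d [^] n" c] minus_equality[of "d [^] n" "\<ominus> c"] by simp
qed

lemma eval_replicate_one:
  assumes "x \<in> carrier L"
  shows "eval (replicate n \<one>) x = (\<Oplus>j\<in>{..<n}. x [^] j)"
  using assms by (induction n) (auto simp: lessThan_Suc finsum_insert Pi_def)

lemma prime_root_of_unity_exists:
  assumes "Factorial_Ring.prime (q::nat)" "[q] \<cdot> \<one> \<noteq> \<zero>"
  obtains w where "w \<in> carrier L" "\<And>j::nat. w [^] j = \<one> \<longleftrightarrow> q dvd j"
proof -
  have q: "q \<ge> 2" using assms(1) by (rule prime_ge_2_nat)
  \<comment> \<open>The polynomial is \<open>1 + X + \<dots> + X\<^sup>q\<^sup>-\<^sup>1\<close>, whose value at \<open>\<one>\<close> is \<open>q\<close>; so its root is not \<open>\<one>\<close>.\<close>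
  let ?p = "replicate q \<one>"
  have "?p \<noteq> []" "lead_coeff ?p \<noteq> \<zero>" "degree ?p > 0" "set ?p \<subseteq> carrier L"
    using q by auto
  then obtain w where w: "w \<in> carrier L" "(\<Oplus>j\<in>{..<q}. w [^] j) = \<zero>"
    using root_exists[of ?p] eval_replicate_one by metis
  have 1: "w [^] q = \<one>"
    using geometric_sum_shift[of w q] w by simp
  have "w \<noteq> \<one>"
    using w(2) assms(2) add.finprod_const[of \<one> "{..<q}"] by auto
  moreover have "w \<noteq> \<zero>"
    using 1 q by (auto simp: nat_pow_zero)
  ultimately have wM: "w \<in> carrier (Multiplicative_Group.mult_of L)" "w \<noteq> \<one>\<^bsub>Multiplicative_Group.mult_of L\<^esub>"
    using w by auto
  interpret M: group "Multiplicative_Group.mult_of L" by (rule field_mult_group)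
  note pow = M.pow_eq_id[OF wM(1), unfolded Multiplicative_Group.mult_of_simps]
  have "M.ord w dvd q" using pow 1 by blast
  moreover have "M.ord w \<noteq> 1" using M.ord_eq_1[OF wM(1)] wM(2) by auto
  ultimately have "M.ord w = q" using assms(1) by (auto simp: prime_nat_iff)
  then show thesis using that[of w] w(1) pow by auto
qed

text \<open>
  Induction over the prime factorization: to pass from \<open>m\<close> to \<open>q * m\<close>, take a \<open>q\<close>-th root of a
  primitive \<open>m\<close>-th root of unity if \<open>q\<close> divides \<open>m\<close>, and multiply it by a primitive \<open>q\<close>-th root of
  unity otherwise.
\<close>
lemma primitive_root_of_unity_exists:
  assumes "[n] \<cdot> \<one> \<noteq> \<zero>"
  obtains z where "z \<in> carrier L" "\<And>j::nat. z [^] j = \<one> \<longleftrightarrow> n dvd j"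
proof -
  have "\<exists>z\<in>carrier L. \<forall>j::nat. z [^] j = \<one> \<longleftrightarrow> n dvd j"
    using assms
  proof (induction n rule: prime_divisors_induct)
    case zero
    then show ?case by simp
  next
    case (unit n)
    then show ?case by (intro bexI[of _ \<one>]) auto
  next
    case (factor q m)
    have nz: "[q] \<cdot> \<one> \<noteq> \<zero>" "[m] \<cdot> \<one> \<noteq> \<zero>"
    proof -
      have "[(q * m)] \<cdot> \<one> = ([q] \<cdot> \<one>) \<otimes> ([m] \<cdot> \<one>)"
        by (simp add: add_pow_ldistr add.nat_pow_pow mult.commute)
      then show "[q] \<cdot> \<one> \<noteq> \<zero>" "[m] \<cdot> \<one> \<noteq> \<zero>"
        using factor.prems by auto
    qed
    obtain z where z: "z \<in> carrier L" "\<And>j::nat. z [^] j = \<one> \<longleftrightarrow> m dvd j"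
      using factor.IH nz(2) by blast
    have q: "Factorial_Ring.prime q" "q > 0" using factor.hyps prime_gt_0_nat by auto
    show ?case
    proof (cases "q dvd m")
      case True
      obtain y where y: "y \<in> carrier L" "y [^] q = z"
        using nth_root_exists[OF z(1) q(2)] by blast
      have "q * m dvd j" if j: "y [^] j = \<one>" for j :: nat
      proof -
        have "z [^] j = \<one>"
          using j y(1) nat_pow_pow[OF y(1), of q j] nat_pow_pow[OF y(1), of j q]
          by (simp add: mult.commute flip: y(2))
        then obtain i where i: "j = q * i"
          using z(2) True by (meson dvd_def dvd_trans)
        then have "z [^] i = \<one>" using j y by (simp add: nat_pow_pow flip: y(2))
        then show ?thesis using z(2) i by simp
      qed
      moreover have "y [^] j = \<one>" if qm: "q * m dvd j" for j :: nat
      proof -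
        obtain i where "j = q * m * i" using qm by (rule dvdE)
        then have "j = q * (m * i)" by (simp add: mult.assoc)
        then have "y [^] j = z [^] (m * i)" using y by (simp add: nat_pow_pow flip: y(2))
        then show ?thesis using z(2) by simp
      qed
      ultimately show ?thesis using y(1) by blast
    next
      case False
      obtain w where w: "w \<in> carrier L" "\<And>j::nat. w [^] j = \<one> \<longleftrightarrow> q dvd j"
        using prime_root_of_unity_exists[OF q(1) nz(1)] by blast
      have cop: "coprime q m" using q(1) False by (simp add: prime_imp_coprime)
      have pow: "(w \<otimes> z) [^] j = w [^] j \<otimes> z [^] j" for j :: nat
        using w(1) z(1) by (simp add: nat_pow_distrib)
      have "q * m dvd j" if j: "(w \<otimes> z) [^] j = \<one>" for j :: nat
      proof -
        have "(w \<otimes> z) [^] (j * q) = \<one>"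
          using j w(1) z(1) by (simp flip: nat_pow_pow)
        then have "z [^] (j * q) = \<one>"
          using pow[of "j * q"] w(2)[of "j * q"] z(1) by simp
        then have m: "m dvd j"
          using z(2) cop by (simp add: coprime_dvd_mult_left_iff coprime_commute)
        then have "w [^] j = \<one>" using j pow z(2)[of j] w(1) by simp
        then show ?thesis using w(2) m cop by (simp add: semiring_gcd_class.divides_mult)
      qed
      moreover have "(w \<otimes> z) [^] j = \<one>" if "q * m dvd j" for j :: nat
        using that pow w(2)[of j] z(2)[of j] by (auto dest: dvd_mult_left dvd_mult_right)
      ultimately show ?thesis using w(1) z(1) by blast
    qed
  qed
  then show thesis using that by blast
qed

text \<open>
  The orthogonality relation for the characters of a cyclic group of order \<open>n\<close>.
\<close>
lemma root_of_unity_power_sum: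
  assumes "z \<in> carrier L" "\<And>j::nat. z [^] j = \<one> \<longleftrightarrow> n dvd j"
  shows "(\<Oplus>i\<in>{..<n}. (z [^] j) [^] i) = (if n dvd j then [n] \<cdot> \<one> else \<zero>)"
proof (cases "n dvd j")
  case True
  then have "z [^] j = \<one>" using assms(2) by blast
  with True show ?thesis using add.finprod_const[of \<one> "{..<n}"] by simp
next
  case False
  let ?y = "z [^] j" and ?S = "\<Oplus>i\<in>{..<n}. (z [^] j) [^] i"
  have y: "?y \<in> carrier L" "?y [^] n = \<one>" "?y \<noteq> \<one>"
    using assms False by (auto simp: nat_pow_pow)
  have S: "?S \<in> carrier L" using y by (simp add: Pi_def)
  have "?y \<otimes> ?S = ?S"
    using geometric_sum_shift[OF y(1), of n] y S by simp
  then have "(?y \<ominus> \<one>) \<otimes> ?S = \<zero>"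
    using y S by (simp add: minus_eq l_distr l_minus r_neg)
  then show ?thesis using y S False by (auto simp: integral_iff)
qed

end

section \<open>Central elements of reduced rings\<close>

definition reduced_ring :: "('a, 'm) ring_scheme \<Rightarrow> bool" where
  "reduced_ring R \<longleftrightarrow> (\<forall>x\<in>carrier R. x \<otimes>\<^bsub>R\<^esub> x = \<zero>\<^bsub>R\<^esub> \<longrightarrow> x = \<zero>\<^bsub>R\<^esub>)"

context ring begin

lemma geometric_sum_absorb:
  assumes "s \<in> carrier R" "s [^] (n::nat) = \<one>"
  shows "s \<otimes> (\<Oplus>j\<in>{..<n}. s [^] j) = (\<Oplus>j\<in>{..<n}. s [^] j)"
proof -
  have "(\<Oplus>j\<in>{..<n}. s [^] j) \<in> carrier R"
    using assms by (simp add: Pi_def)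
  then show ?thesis
    using geometric_sum_shift[OF assms(1), of n] assms by simp
qed

text \<open>
  If \<open>n\<close> is invertible, the sum divided by \<open>n\<close> is therefore an idempotent; if \<open>n\<close> vanishes in the ring,
  the sum squares to zero. Both readings are used.
\<close>
lemma geometric_sum_square:
  assumes "s \<in> carrier R" "s [^] (n::nat) = \<one>"
  defines "N \<equiv> \<Oplus>j\<in>{..<n}. s [^] j"
  shows "N \<otimes> N = [n] \<cdot> N"
proof -
  have N: "N \<in> carrier R" using assms by (simp add: N_def Pi_def)
  have absorb: "s [^] j \<otimes> N = N" for j :: nat
  proof (induction j)
    case (Suc j)
    then show ?case
      using assms(1) N geometric_sum_absorb[OF assms(1,2)] by (simp add: m_assoc flip: N_def)
  qed (use N in simp)
  have "N \<otimes> N = (\<Oplus>j\<in>{..<n}. s [^] j \<otimes> N)"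
    using assms(1) N finsum_ldistr[of "{..<n}" N "\<lambda>j. s [^] j"] by (simp add: N_def Pi_def)
  then show ?thesis
    using N absorb add.finprod_const[of N "{..<n}"] by simp
qed

lemma reduced_zero_product:
  assumes "reduced_ring R" "a \<in> carrier R" "b \<in> carrier R" "x \<in> carrier R" "a \<otimes> b = \<zero>"
  shows "b \<otimes> x \<otimes> a = \<zero>"
proof -
  have "(b \<otimes> x \<otimes> a) \<otimes> (b \<otimes> x \<otimes> a) = (b \<otimes> x) \<otimes> (a \<otimes> b) \<otimes> (x \<otimes> a)"
    using assms(2-4) by (simp add: m_assoc)
  also have "\<dots> = \<zero>" using assms(2-5) by simp
  finally have square: "(b \<otimes> x \<otimes> a) \<otimes> (b \<otimes> x \<otimes> a) = \<zero>" .
  have "b \<otimes> x \<otimes> a \<in> carrier R" using assms(2-4) by simp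
  with square assms(1) show ?thesis unfolding reduced_ring_def by blast
qed

text \<open>
  In a reduced ring idempotents are central: with \<open>f = n - e\<close> both \<open>e x f\<close> and \<open>f x e\<close> square to zero,
  so \<open>n e x = e x e = n x e\<close>. Keeping the factor \<open>n\<close> avoids division in the ring.
\<close>
lemma reduced_scaled_idempotent_central:
  assumes "reduced_ring R" "e \<in> carrier R" "e \<otimes> e = [(n::nat)] \<cdot> e"
    and inv: "\<And>y. y \<in> carrier R \<Longrightarrow> [n] \<cdot> y = \<zero> \<Longrightarrow> y = \<zero>"
    and x: "x \<in> carrier R"
  shows "e \<otimes> x = x \<otimes> e"
proof -
  define c where "c = [n] \<cdot> \<one>"
  have c: "c \<in> carrier R" by (simp add: c_def)
  have c_mult: "c \<otimes> y = [n] \<cdot> y" "y \<otimes> c = [n] \<cdot> y" if "y \<in> carrier R" for y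
    using that by (simp_all add: c_def add_pow_ldistr add_pow_rdistr)
  have c_comm: "y \<otimes> c = c \<otimes> y" if "y \<in> carrier R" for y
    using that by (simp add: c_mult)
  have ee: "e \<otimes> e = c \<otimes> e" using assms(2,3) by (simp add: c_mult)
  define f where "f = c \<ominus> e"
  have f: "f \<in> carrier R" using assms(2) c by (simp add: f_def)
  have f_mult: "f \<otimes> y = c \<otimes> y \<ominus> e \<otimes> y" "y \<otimes> f = c \<otimes> y \<ominus> y \<otimes> e"
    if "y \<in> carrier R" for y
    using assms(2) c that c_comm[OF that]
    by (simp_all add: f_def minus_eq l_distr r_distr l_minus r_minus)
  have "e \<otimes> f = \<zero>" "f \<otimes> e = \<zero>"
    using assms(2) c by (simp_all add: f_mult ee)
  then have "f \<otimes> x \<otimes> e = \<zero>" "e \<otimes> x \<otimes> f = \<zero>"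
    using reduced_zero_product[OF assms(1)] f assms(2) x by blast+
  then have "f \<otimes> (x \<otimes> e) = \<zero>" "(e \<otimes> x) \<otimes> f = \<zero>"
    using m_assoc[OF f x assms(2)] by metis+
  then have "c \<otimes> (x \<otimes> e) \<ominus> e \<otimes> (x \<otimes> e) = \<zero>" "c \<otimes> (e \<otimes> x) \<ominus> (e \<otimes> x) \<otimes> e = \<zero>"
    using f_mult(1)[of "x \<otimes> e"] f_mult(2)[of "e \<otimes> x"] assms(2) x by simp_all
  then have "c \<otimes> (e \<otimes> x) = (e \<otimes> x) \<otimes> e" "c \<otimes> (x \<otimes> e) = e \<otimes> (x \<otimes> e)"
    using assms(2) x c by simp_all
  then have "c \<otimes> (e \<otimes> x) = c \<otimes> (x \<otimes> e)"
    using m_assoc[OF assms(2) x assms(2)] by metis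
  moreover have "c \<otimes> (e \<otimes> x \<ominus> x \<otimes> e) = c \<otimes> (e \<otimes> x) \<ominus> c \<otimes> (x \<otimes> e)"
    using assms(2) x c by (simp add: minus_eq r_distr r_minus)
  ultimately have "c \<otimes> (e \<otimes> x \<ominus> x \<otimes> e) = \<zero>"
    using assms(2) x c by simp
  then have "e \<otimes> x \<ominus> x \<otimes> e = \<zero>"
    using inv assms(2) x c_mult(1)[of "e \<otimes> x \<ominus> x \<otimes> e"] by simp
  then show ?thesis using assms(2) x by simp
qed

lemma commute_finsum:
  assumes "finite I" "\<And>i. i \<in> I \<Longrightarrow> f i \<in> carrier R" "x \<in> carrier R"
    and "\<And>i. i \<in> I \<Longrightarrow> f i \<otimes> x = x \<otimes> f i"
  shows "(\<Oplus>i\<in>I. f i) \<otimes> x = x \<otimes> (\<Oplus>i\<in>I. f i)"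
proof -
  have "(\<Oplus>i\<in>I. f i) \<otimes> x = (\<Oplus>i\<in>I. f i \<otimes> x)"
    using assms by (intro finsum_ldistr) auto
  also have "\<dots> = (\<Oplus>i\<in>I. x \<otimes> f i)"
    using assms by (intro finsum_cong') auto
  also have "\<dots> = x \<otimes> (\<Oplus>i\<in>I. f i)"
    using assms by (intro finsum_rdistr[symmetric]) auto
  finally show ?thesis .
qed

end

section \<open>Periodic elements of reduced algebras\<close>

context associative_algebra begin

lemma smult_nat_one:
  assumes "x \<in> carrier A"
  shows "([n] \<cdot>\<^bsub>K\<^esub> \<one>\<^bsub>K\<^esub>) \<odot>\<^bsub>A\<^esub> x = [(n::nat)] \<cdot>\<^bsub>A\<^esub> x"
  using assms by (induction n) (simp_all add: smult_l_distr)

lemma smult_pow: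
  assumes "a \<in> carrier K" "x \<in> carrier A"
  shows "(a \<odot>\<^bsub>A\<^esub> x) [^]\<^bsub>A\<^esub> n = (a [^]\<^bsub>K\<^esub> n) \<odot>\<^bsub>A\<^esub> (x [^]\<^bsub>A\<^esub> (n::nat))"
  using assms
  by (induction n) (simp_all add: smult_mult_left smult_mult_right smult_assoc1[symmetric] R.m_comm)

lemma smult_Unit_cancel:
  assumes "a \<in> Units K" "x \<in> carrier A" "y \<in> carrier A" "a \<odot>\<^bsub>A\<^esub> x = a \<odot>\<^bsub>A\<^esub> y"
  shows "x = y"
proof -
  have "inv\<^bsub>K\<^esub> a \<odot>\<^bsub>A\<^esub> (a \<odot>\<^bsub>A\<^esub> v) = v" if "v \<in> carrier A" for v
    using assms(1) that by (simp add: R.Units_closed flip: smult_assoc1)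
  then show ?thesis using assms(2-4) by metis
qed

lemma smult_Unit_commute_iff:
  assumes "a \<in> Units K" "x \<in> carrier A" "y \<in> carrier A"
  shows "(a \<odot>\<^bsub>A\<^esub> x) \<otimes>\<^bsub>A\<^esub> y = y \<otimes>\<^bsub>A\<^esub> (a \<odot>\<^bsub>A\<^esub> x) \<longleftrightarrow> x \<otimes>\<^bsub>A\<^esub> y = y \<otimes>\<^bsub>A\<^esub> x"
  using assms smult_Unit_cancel[OF assms(1), of "x \<otimes>\<^bsub>A\<^esub> y" "y \<otimes>\<^bsub>A\<^esub> x"]
  by (auto simp: smult_mult_left smult_mult_right R.Units_closed)

lemma finsum_smult_rdistr:
  assumes "finite I" "c \<in> I \<rightarrow> carrier K" "x \<in> carrier A"
  shows "(\<Oplus>\<^bsub>K\<^esub>i\<in>I. c i) \<odot>\<^bsub>A\<^esub> x = (\<Oplus>\<^bsub>A\<^esub>i\<in>I. c i \<odot>\<^bsub>A\<^esub> x)"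
  using assms by (induction I rule: finite_induct) (auto simp: smult_l_distr Pi_def)

text \<open>
  For a primitive \<open>n\<close>-th root of unity \<open>z\<close> the element \<open>N i = (\<Sum>j<n. (z\<^sup>i s)\<^sup>j)\<close> is \<open>n\<close> times the idempotent that
  projects onto the eigenspace of \<open>s\<close> with eigenvalue \<open>z\<^sup>-\<^sup>i\<close>, hence central. On it \<open>s\<close> acts as a
  scalar, so \<open>s N i\<close> is central as well, and the sum of the \<open>s N i\<close> over all \<open>i\<close> is \<open>n s\<close>.
\<close>
lemma reduced_periodic_central:
  assumes "algebraically_closed K" "reduced_ring A" "[n] \<cdot>\<^bsub>K\<^esub> \<one>\<^bsub>K\<^esub> \<noteq> \<zero>\<^bsub>K\<^esub>"
    and s: "s \<in> carrier A" "s [^]\<^bsub>A\<^esub> (n::nat) = \<one>\<^bsub>A\<^esub>" and x: "x \<in> carrier A"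
  shows "s \<otimes>\<^bsub>A\<^esub> x = x \<otimes>\<^bsub>A\<^esub> s"
proof -
  interpret K: algebraically_closed K by fact
  have n: "[n] \<cdot>\<^bsub>K\<^esub> \<one>\<^bsub>K\<^esub> \<in> Units K"
    using assms(3) K.field_Units by simp
  have "n > 0" using assms(3) by (cases n) auto
  obtain z where z: "z \<in> carrier K" "\<And>j::nat. z [^]\<^bsub>K\<^esub> j = \<one>\<^bsub>K\<^esub> \<longleftrightarrow> n dvd j"
    using K.primitive_root_of_unity_exists[OF assms(3)] by blast
  have z_Unit: "z [^]\<^bsub>K\<^esub> i \<in> Units K" for i :: nat
  proof -
    have "z \<noteq> \<zero>\<^bsub>K\<^esub>" using z(2)[of n] \<open>n > 0\<close> by (auto simp: R.nat_pow_zero)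
    then show ?thesis using z(1) K.field_Units R.Units_pow_closed by auto
  qed
  define t where "t i = (z [^]\<^bsub>K\<^esub> i) \<odot>\<^bsub>A\<^esub> s" for i :: nat
  define N where "N i = (\<Oplus>\<^bsub>A\<^esub>j\<in>{..<n}. t i [^]\<^bsub>A\<^esub> j)" for i
  have t: "t i \<in> carrier A" for i using z s by (simp add: t_def)
  have N: "N i \<in> carrier A" for i using t by (simp add: N_def Pi_def)
  have t_pow: "t i [^]\<^bsub>A\<^esub> n = \<one>\<^bsub>A\<^esub>" for i
  proof -
    have "(z [^]\<^bsub>K\<^esub> i) [^]\<^bsub>K\<^esub> n = \<one>\<^bsub>K\<^esub>"
      using z by (simp add: R.nat_pow_pow)
    then show ?thesis using z s by (simp add: t_def smult_pow del: R.nat_pow_pow)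
  qed
  have inv: "y = \<zero>\<^bsub>A\<^esub>" if "y \<in> carrier A" "[n] \<cdot>\<^bsub>A\<^esub> y = \<zero>\<^bsub>A\<^esub>" for y
    using smult_Unit_cancel[OF n, of y "\<zero>\<^bsub>A\<^esub>"] that n by (simp add: smult_nat_one R.Units_closed)
  have N_central: "N i \<otimes>\<^bsub>A\<^esub> x = x \<otimes>\<^bsub>A\<^esub> N i" for i
    by (rule A.reduced_scaled_idempotent_central[OF assms(2) N _ inv x])
      (simp_all add: A.geometric_sum_square[OF t t_pow] N_def)
  have sN_central: "(s \<otimes>\<^bsub>A\<^esub> N i) \<otimes>\<^bsub>A\<^esub> x = x \<otimes>\<^bsub>A\<^esub> (s \<otimes>\<^bsub>A\<^esub> N i)" for i
  proof -
    have "t i \<otimes>\<^bsub>A\<^esub> N i = N i"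
      unfolding N_def by (rule A.geometric_sum_absorb[OF t t_pow])
    then have "(z [^]\<^bsub>K\<^esub> i) \<odot>\<^bsub>A\<^esub> (s \<otimes>\<^bsub>A\<^esub> N i) = N i"
      using z s N[of i] by (simp add: smult_mult_left t_def)
    then show ?thesis
      using smult_Unit_commute_iff[OF z_Unit, of "s \<otimes>\<^bsub>A\<^esub> N i" x i] N N_central s x by simp
  qed
  have sum_N: "(\<Oplus>\<^bsub>A\<^esub>i\<in>{..<n}. N i) = ([n] \<cdot>\<^bsub>K\<^esub> \<one>\<^bsub>K\<^esub>) \<odot>\<^bsub>A\<^esub> \<one>\<^bsub>A\<^esub>"
  proof -
    have "(\<Oplus>\<^bsub>A\<^esub>i\<in>{..<n}. N i)
        = (\<Oplus>\<^bsub>A\<^esub>i\<in>{..<n}. \<Oplus>\<^bsub>A\<^esub>j\<in>{..<n}. ((z [^]\<^bsub>K\<^esub> j) [^]\<^bsub>K\<^esub> i) \<odot>\<^bsub>A\<^esub> (s [^]\<^bsub>A\<^esub> j))"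
      using z s by (simp add: N_def t_def smult_pow R.nat_pow_pow mult.commute)
    also have "\<dots> = (\<Oplus>\<^bsub>A\<^esub>j\<in>{..<n}. \<Oplus>\<^bsub>A\<^esub>i\<in>{..<n}. ((z [^]\<^bsub>K\<^esub> j) [^]\<^bsub>K\<^esub> i) \<odot>\<^bsub>A\<^esub> (s [^]\<^bsub>A\<^esub> j))"
      using z s by (intro M.finsum_swap) auto
    also have "\<dots> = (\<Oplus>\<^bsub>A\<^esub>j\<in>{..<n}. (\<Oplus>\<^bsub>K\<^esub>i\<in>{..<n}. (z [^]\<^bsub>K\<^esub> j) [^]\<^bsub>K\<^esub> i) \<odot>\<^bsub>A\<^esub> (s [^]\<^bsub>A\<^esub> j))"
      using z s by (intro M.finsum_cong') (auto simp: finsum_smult_rdistr simp del: R.nat_pow_pow)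
    also have "\<dots> = (\<Oplus>\<^bsub>A\<^esub>j\<in>{..<n}. if j = 0 then ([n] \<cdot>\<^bsub>K\<^esub> \<one>\<^bsub>K\<^esub>) \<odot>\<^bsub>A\<^esub> \<one>\<^bsub>A\<^esub> else \<zero>\<^bsub>A\<^esub>)"
      using s K.root_of_unity_power_sum[OF z]
      by (intro M.finsum_cong') (auto simp del: R.nat_pow_pow dest: nat_dvd_not_less)
    also have "\<dots> = ([n] \<cdot>\<^bsub>K\<^esub> \<one>\<^bsub>K\<^esub>) \<odot>\<^bsub>A\<^esub> \<one>\<^bsub>A\<^esub>"
      using \<open>n > 0\<close> M.add.finprod_singleton_swap[of 0 "{..<n}" "\<lambda>_. ([n] \<cdot>\<^bsub>K\<^esub> \<one>\<^bsub>K\<^esub>) \<odot>\<^bsub>A\<^esub> \<one>\<^bsub>A\<^esub>"] by simp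
    finally show ?thesis .
  qed
  have "([n] \<cdot>\<^bsub>K\<^esub> \<one>\<^bsub>K\<^esub>) \<odot>\<^bsub>A\<^esub> s = s \<otimes>\<^bsub>A\<^esub> (\<Oplus>\<^bsub>A\<^esub>i\<in>{..<n}. N i)"
    using s n by (simp add: sum_N smult_mult_right R.Units_closed)
  also have "\<dots> = (\<Oplus>\<^bsub>A\<^esub>i\<in>{..<n}. s \<otimes>\<^bsub>A\<^esub> N i)"
    using s N by (intro A.finsum_rdistr) auto
  finally have "(([n] \<cdot>\<^bsub>K\<^esub> \<one>\<^bsub>K\<^esub>) \<odot>\<^bsub>A\<^esub> s) \<otimes>\<^bsub>A\<^esub> x = x \<otimes>\<^bsub>A\<^esub> (([n] \<cdot>\<^bsub>K\<^esub> \<one>\<^bsub>K\<^esub>) \<odot>\<^bsub>A\<^esub> s)"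
    using A.commute_finsum[of "{..<n}" "\<lambda>i. s \<otimes>\<^bsub>A\<^esub> N i" x] s N x sN_central by simp
  then show ?thesis
    using smult_Unit_commute_iff[OF n s(1) x] by simp
qed

end

section \<open>Twisted group algebras without nonzero nilpotent elements\<close>

context twisted_group_algebra begin

lemma u_closed [simp]: "g \<in> carrier G \<Longrightarrow> u g \<in> carrier A"
  using basis by (auto simp: basis_family_def)

lemma factor_closed [simp]: "\<lbrakk>g \<in> carrier G; h \<in> carrier G\<rbrakk> \<Longrightarrow> \<rho> g h \<in> carrier K"
  using factor_nonzero by blast

lemma combination_closed:
  assumes "F \<subseteq> carrier G" "c \<in> F \<rightarrow> carrier K"
  shows "(\<Oplus>\<^bsub>A\<^esub>g\<in>F. c g \<odot>\<^bsub>A\<^esub> u g) \<in> carrier A"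
  using assms by (intro M.finsum_closed) (auto simp: Pi_def subset_iff)

lemma basis_induct [consumes 1, case_names zero add]:
  assumes "x \<in> carrier A" "P \<zero>\<^bsub>A\<^esub>"
    and "\<And>a g x. \<lbrakk>a \<in> carrier K; g \<in> carrier G; x \<in> carrier A; P x\<rbrakk> \<Longrightarrow> P (a \<odot>\<^bsub>A\<^esub> u g \<oplus>\<^bsub>A\<^esub> x)"
  shows "P x"
proof -
  obtain F c where Fc: "finite F" "F \<subseteq> carrier G" "c \<in> F \<rightarrow> carrier K"
    and x: "x = (\<Oplus>\<^bsub>A\<^esub>g\<in>F. c g \<odot>\<^bsub>A\<^esub> u g)"
    using basis assms(1) unfolding basis_family_def spanning_family_def by blast
  from Fc have "P (\<Oplus>\<^bsub>A\<^esub>g\<in>F. c g \<odot>\<^bsub>A\<^esub> u g)"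
  proof (induction F rule: finite_induct)
    case empty
    then show ?case using assms(2) by simp
  next
    case (insert g F)
    then have "(\<Oplus>\<^bsub>A\<^esub>g\<in>insert g F. c g \<odot>\<^bsub>A\<^esub> u g) = c g \<odot>\<^bsub>A\<^esub> u g \<oplus>\<^bsub>A\<^esub> (\<Oplus>\<^bsub>A\<^esub>g\<in>F. c g \<odot>\<^bsub>A\<^esub> u g)"
      by (intro M.finsum_insert) (auto simp: Pi_def subset_iff)
    then show ?case
      using insert assms(3) combination_closed[of F c] by auto
  qed
  then show ?thesis by (simp add: x)
qed

lemma basis_one: "u \<one>\<^bsub>G\<^esub> = \<one>\<^bsub>A\<^esub>"
proof -
  have "u \<one>\<^bsub>G\<^esub> \<otimes>\<^bsub>A\<^esub> x = x" if "x \<in> carrier A" for x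
    using that
  proof (induction rule: basis_induct)
    case (add a g x)
    then show ?case
      by (simp add: A.r_distr smult_mult_right basis_mult factor_one_left)
  qed simp
  from this[of "\<one>\<^bsub>A\<^esub>"] show ?thesis by simp
qed

lemma commute_basis_imp_central:
  assumes "y \<in> carrier A" "\<And>h. h \<in> carrier G \<Longrightarrow> y \<otimes>\<^bsub>A\<^esub> u h = u h \<otimes>\<^bsub>A\<^esub> y" "x \<in> carrier A"
  shows "y \<otimes>\<^bsub>A\<^esub> x = x \<otimes>\<^bsub>A\<^esub> y"
  using assms(3)
proof (induction rule: basis_induct)
  case (add a g x)
  then show ?case
    using assms(1,2) by (simp add: A.r_distr A.l_distr smult_mult_right smult_mult_left)
qed (use assms(1) in simp)

lemma independent_reindexed:
  assumes "finite J" "inj_on f J" "f \<in> J \<rightarrow> carrier G" "c \<in> J \<rightarrow> carrier K"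
    and "(\<Oplus>\<^bsub>A\<^esub>j\<in>J. c j \<odot>\<^bsub>A\<^esub> u (f j)) = \<zero>\<^bsub>A\<^esub>" "j \<in> J"
  shows "c j = \<zero>\<^bsub>K\<^esub>"
proof -
  define c' where "c' = c \<circ> the_inv_into J f"
  have c': "c' (f i) = c i" if "i \<in> J" for i
    using that assms(2) by (simp add: c'_def the_inv_into_f_f)
  have "(\<Oplus>\<^bsub>A\<^esub>g\<in>f ` J. c' g \<odot>\<^bsub>A\<^esub> u g) = (\<Oplus>\<^bsub>A\<^esub>i\<in>J. c' (f i) \<odot>\<^bsub>A\<^esub> u (f i))"
    using assms(2-4) c' by (intro M.finsum_reindex) (auto simp: Pi_def)
  also have "\<dots> = (\<Oplus>\<^bsub>A\<^esub>j\<in>J. c j \<odot>\<^bsub>A\<^esub> u (f j))"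
    using assms(3,4) c' by (intro M.finsum_cong') (auto simp: Pi_def)
  finally have "(\<Oplus>\<^bsub>A\<^esub>g\<in>f ` J. c' g \<odot>\<^bsub>A\<^esub> u g) = \<zero>\<^bsub>A\<^esub>" using assms(5) by simp
  moreover have "finite (f ` J)" "f ` J \<subseteq> carrier G" "c' \<in> f ` J \<rightarrow> carrier K"
    using assms(1,3,4) c' by auto
  ultimately have "\<forall>g\<in>f ` J. c' g = \<zero>\<^bsub>K\<^esub>"
    using basis unfolding basis_family_def independent_family_def by blast
  then show ?thesis using c' assms(6) by auto
qed

lemma scaled_basis_eqD:
  assumes "a \<in> carrier K" "a \<noteq> \<zero>\<^bsub>K\<^esub>" "b \<in> carrier K" "g \<in> carrier G" "h \<in> carrier G"
    and eq: "a \<odot>\<^bsub>A\<^esub> u g = b \<odot>\<^bsub>A\<^esub> u h"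
  shows "g = h" "a = b"
proof -
  show gh: "g = h"
  proof (rule ccontr)
    assume ne: "g \<noteq> h"
    define c where "c k = (if k = g then a else \<ominus>\<^bsub>K\<^esub> b)" for k
    have "(\<Oplus>\<^bsub>A\<^esub>k\<in>{g, h}. c k \<odot>\<^bsub>A\<^esub> u k) = \<zero>\<^bsub>A\<^esub>"
      using ne assms by (simp add: c_def smult_l_minus M.r_neg)
    then have "c g = \<zero>\<^bsub>K\<^esub>"
      using assms ne independent_reindexed[of "{g, h}" "\<lambda>k. k" c g] by (auto simp: c_def)
    then show False using assms(2) by (simp add: c_def)
  qed
  have "(\<Oplus>\<^bsub>A\<^esub>k\<in>{g}. (a \<ominus>\<^bsub>K\<^esub> b) \<odot>\<^bsub>A\<^esub> u k) = \<zero>\<^bsub>A\<^esub>"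
    using assms gh by (simp add: K.minus_eq smult_l_distr smult_l_minus M.r_neg)
  then have "a \<ominus>\<^bsub>K\<^esub> b = \<zero>\<^bsub>K\<^esub>"
    using assms independent_reindexed[of "{g}" "\<lambda>k. k" "\<lambda>_. a \<ominus>\<^bsub>K\<^esub> b" g] by auto
  then show "a = b" using assms by simp
qed

lemma basis_pow:
  assumes "g \<in> carrier G"
  shows "\<exists>c\<in>carrier K - {\<zero>\<^bsub>K\<^esub>}. u g [^]\<^bsub>A\<^esub> n = c \<odot>\<^bsub>A\<^esub> u (g [^]\<^bsub>G\<^esub> (n::nat))"
proof (induction n)
  case 0
  then show ?case by (intro bexI[of _ "\<one>\<^bsub>K\<^esub>"]) (auto simp: basis_one)
next
  case (Suc n)
  then obtain c where c: "c \<in> carrier K - {\<zero>\<^bsub>K\<^esub>}" "u g [^]\<^bsub>A\<^esub> n = c \<odot>\<^bsub>A\<^esub> u (g [^]\<^bsub>G\<^esub> n)"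
    by blast
  have "\<rho> (g [^]\<^bsub>G\<^esub> n) g \<in> carrier K - {\<zero>\<^bsub>K\<^esub>}" using assms factor_nonzero by simp
  then show ?case
    using c assms
    by (intro bexI[of _ "c \<otimes>\<^bsub>K\<^esub> \<rho> (g [^]\<^bsub>G\<^esub> n) g"])
      (auto simp: smult_mult_left basis_mult smult_assoc1 K.integral_iff)
qed

text \<open>
  Some power of \<open>u g\<close> is a nonzero scalar, and over an algebraically closed field a root of that
  scalar can be divided out.
\<close>
lemma periodic_multiple_exists:
  assumes "algebraically_closed K" "g \<in> carrier G" "g [^]\<^bsub>G\<^esub> n = \<one>\<^bsub>G\<^esub>" "n > (0::nat)"
  obtains d where "d \<in> Units K" "(d \<odot>\<^bsub>A\<^esub> u g) [^]\<^bsub>A\<^esub> n = \<one>\<^bsub>A\<^esub>"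
proof -
  interpret K: algebraically_closed K by fact
  obtain c where c: "c \<in> carrier K - {\<zero>\<^bsub>K\<^esub>}" "u g [^]\<^bsub>A\<^esub> n = c \<odot>\<^bsub>A\<^esub> \<one>\<^bsub>A\<^esub>"
    using basis_pow[OF assms(2), of n] assms(3) by (auto simp: basis_one)
  then have cU: "c \<in> Units K" using K.field_Units by simp
  then have "inv\<^bsub>K\<^esub> c \<in> carrier K" by simp
  then obtain d where d: "d \<in> carrier K" "d [^]\<^bsub>K\<^esub> n = inv\<^bsub>K\<^esub> c"
    using K.nth_root_exists assms(4) by blast
  have "inv\<^bsub>K\<^esub> c \<noteq> \<zero>\<^bsub>K\<^esub>"
    using K.Units_l_inv[OF cU] c by auto
  then have "d \<noteq> \<zero>\<^bsub>K\<^esub>" using d(2) assms(4) by (auto simp: K.nat_pow_zero)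
  then have "d \<in> Units K" using d(1) K.field_Units by simp
  moreover have "(d \<odot>\<^bsub>A\<^esub> u g) [^]\<^bsub>A\<^esub> n = \<one>\<^bsub>A\<^esub>"
    using d c cU assms(2) by (simp add: smult_pow flip: smult_assoc1)
  ultimately show thesis by (rule that)
qed

text \<open>
  Let \<open>s\<close> be a multiple of \<open>u g\<close> with \<open>s\<^sup>n = 1\<close>, where \<open>n\<close> is the order of \<open>g\<close>. If \<open>n\<close> vanished in \<open>K\<close>, the
  sum of the powers \<open>s\<^sup>j\<close>, \<open>j < n\<close>, would square to zero. It is not zero, because these powers are
  nonzero multiples of distinct basis elements.
\<close>
lemma reduced_imp_ord_invertible:
  assumes "algebraically_closed K" "reduced_ring A" "g \<in> carrier G" "G.ord g > 0"
  shows "[G.ord g] \<cdot>\<^bsub>K\<^esub> \<one>\<^bsub>K\<^esub> \<noteq> \<zero>\<^bsub>K\<^esub>"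
proof
  assume zero: "[G.ord g] \<cdot>\<^bsub>K\<^esub> \<one>\<^bsub>K\<^esub> = \<zero>\<^bsub>K\<^esub>"
  define n where "n = G.ord g"
  obtain d where d: "d \<in> Units K" "(d \<odot>\<^bsub>A\<^esub> u g) [^]\<^bsub>A\<^esub> n = \<one>\<^bsub>A\<^esub>"
    using periodic_multiple_exists[OF assms(1,3) _ assms(4)] G.pow_ord_eq_1[OF assms(3)]
    unfolding n_def by blast
  define s where "s = d \<odot>\<^bsub>A\<^esub> u g"
  have s: "s \<in> carrier A" "s [^]\<^bsub>A\<^esub> n = \<one>\<^bsub>A\<^esub>"
    using d assms(3) by (auto simp: s_def K.Units_closed)
  define N where "N = (\<Oplus>\<^bsub>A\<^esub>j\<in>{..<n}. s [^]\<^bsub>A\<^esub> j)"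
  have N: "N \<in> carrier A" using s by (simp add: N_def Pi_def)
  have "N \<otimes>\<^bsub>A\<^esub> N = ([n] \<cdot>\<^bsub>K\<^esub> \<one>\<^bsub>K\<^esub>) \<odot>\<^bsub>A\<^esub> N"
    using A.geometric_sum_square[OF s] N by (simp add: smult_nat_one flip: N_def)
  also have "\<dots> = \<zero>\<^bsub>A\<^esub>" using zero N by (simp add: n_def)
  finally have N0: "N = \<zero>\<^bsub>A\<^esub>" using assms(2) N unfolding reduced_ring_def by blast
  have "\<forall>j::nat. \<exists>c. c \<in> carrier K \<and> c \<noteq> \<zero>\<^bsub>K\<^esub> \<and> s [^]\<^bsub>A\<^esub> j = c \<odot>\<^bsub>A\<^esub> u (g [^]\<^bsub>G\<^esub> j)"
  proof
    fix j :: nat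
    obtain c where c: "c \<in> carrier K - {\<zero>\<^bsub>K\<^esub>}" "u g [^]\<^bsub>A\<^esub> j = c \<odot>\<^bsub>A\<^esub> u (g [^]\<^bsub>G\<^esub> j)"
      using basis_pow[OF assms(3)] by blast
    have dj: "d [^]\<^bsub>K\<^esub> j \<in> carrier K - {\<zero>\<^bsub>K\<^esub>}"
      using d(1) K.Units_pow_closed K.field_Units by blast
    show "\<exists>c. c \<in> carrier K \<and> c \<noteq> \<zero>\<^bsub>K\<^esub> \<and> s [^]\<^bsub>A\<^esub> j = c \<odot>\<^bsub>A\<^esub> u (g [^]\<^bsub>G\<^esub> j)"
      using c dj d(1) assms(3)
      by (intro exI[of _ "d [^]\<^bsub>K\<^esub> j \<otimes>\<^bsub>K\<^esub> c"])
        (auto simp: s_def smult_pow smult_assoc1 K.Units_closed K.integral_iff)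
  qed
  then obtain c where c: "\<And>j::nat. c j \<in> carrier K" "\<And>j. c j \<noteq> \<zero>\<^bsub>K\<^esub>"
      "\<And>j. s [^]\<^bsub>A\<^esub> j = c j \<odot>\<^bsub>A\<^esub> u (g [^]\<^bsub>G\<^esub> j)"
    by metis
  have "inj_on (\<lambda>j. g [^]\<^bsub>G\<^esub> j) {..<n}"
    using G.ord_inj[OF assms(3)] assms(4)
    by (rule_tac inj_on_subset) (auto simp: n_def)
  moreover have "(\<Oplus>\<^bsub>A\<^esub>j\<in>{..<n}. c j \<odot>\<^bsub>A\<^esub> u (g [^]\<^bsub>G\<^esub> j)) = \<zero>\<^bsub>A\<^esub>"
    using N0 by (simp add: N_def c(3))
  ultimately have "c 0 = \<zero>\<^bsub>K\<^esub>"
    using independent_reindexed[of "{..<n}" "\<lambda>j. g [^]\<^bsub>G\<^esub> j" c 0] assms(3,4) c(1)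
    by (auto simp: n_def)
  then show False using c(2) by blast
qed

lemma reduced_imp_basis_commute:
  assumes "algebraically_closed K" "reduced_ring A" "g \<in> carrier G" "G.ord g > 0" "x \<in> carrier A"
  shows "u g \<otimes>\<^bsub>A\<^esub> x = x \<otimes>\<^bsub>A\<^esub> u g"
proof -
  obtain d where d: "d \<in> Units K" "(d \<odot>\<^bsub>A\<^esub> u g) [^]\<^bsub>A\<^esub> G.ord g = \<one>\<^bsub>A\<^esub>"
    using periodic_multiple_exists[OF assms(1,3) _ assms(4)] G.pow_ord_eq_1[OF assms(3)] by blast
  have "(d \<odot>\<^bsub>A\<^esub> u g) \<otimes>\<^bsub>A\<^esub> x = x \<otimes>\<^bsub>A\<^esub> (d \<odot>\<^bsub>A\<^esub> u g)"
    using d assms(3,5) reduced_imp_ord_invertible[OF assms(1-4)]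
    by (intro reduced_periodic_central[OF assms(1,2)]) (auto simp: K.Units_closed)
  then show ?thesis using smult_Unit_commute_iff[OF d(1)] assms(3,5) by simp
qed

lemma basis_commuteD:
  assumes "g \<in> carrier G" "h \<in> carrier G" "u g \<otimes>\<^bsub>A\<^esub> u h = u h \<otimes>\<^bsub>A\<^esub> u g"
  shows "g \<otimes>\<^bsub>G\<^esub> h = h \<otimes>\<^bsub>G\<^esub> g" "\<rho> g h = \<rho> h g"
proof -
  have "\<rho> g h \<odot>\<^bsub>A\<^esub> u (g \<otimes>\<^bsub>G\<^esub> h) = \<rho> h g \<odot>\<^bsub>A\<^esub> u (h \<otimes>\<^bsub>G\<^esub> g)"
    using assms by (simp add: basis_mult)
  then show "g \<otimes>\<^bsub>G\<^esub> h = h \<otimes>\<^bsub>G\<^esub> g" "\<rho> g h = \<rho> h g"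
    using scaled_basis_eqD[of "\<rho> g h" "\<rho> h g" "g \<otimes>\<^bsub>G\<^esub> h" "h \<otimes>\<^bsub>G\<^esub> g"] assms factor_nonzero by auto
qed

end

section \<open>Nilpotent elements of commutative rings\<close>

context cring begin

text \<open>
  The factor \<open>z\<close> makes the induction work: multiplying \<open>z\<close> by \<open>x\<close> or by \<open>y\<close> lowers one of the
  exponents by one, which replaces the binomial theorem.
\<close>
lemma sum_pow_annihilates:
  assumes "x \<in> carrier R" "y \<in> carrier R" "z \<in> carrier R"
    and "x [^] (m::nat) \<otimes> z = \<zero>" "y [^] (n::nat) \<otimes> z = \<zero>"
  shows "(x \<oplus> y) [^] (m + n) \<otimes> z = \<zero>"
  using assms(3-)
proof (induction "m + n" arbitrary: m n z)
  case 0
  then show ?case by simp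
next
  case (Suc k)
  show ?case
  proof (cases "m = 0 \<or> n = 0")
    case True
    then have "z = \<zero>" using Suc.prems by auto
    then show ?thesis using assms(1,2) by simp
  next
    case False
    then obtain m' n' where mn: "m = Suc m'" "n = Suc n'" by (metis not0_implies_Suc)
    have swap: "w [^] (i::nat) \<otimes> (v \<otimes> z) = v \<otimes> (w [^] i \<otimes> z)" if "w \<in> carrier R" "v \<in> carrier R" for w v i
      using that Suc.prems(1) by (simp add: m_lcomm)
    have x: "(x \<oplus> y) [^] (m' + n) \<otimes> (x \<otimes> z) = \<zero>"
    proof (rule Suc.hyps(1))
      show "k = m' + n" using Suc.hyps(2) mn by simp
      show "x [^] m' \<otimes> (x \<otimes> z) = \<zero>"
        using Suc.prems mn assms(1) by (simp add: m_assoc)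
      show "y [^] n \<otimes> (x \<otimes> z) = \<zero>"
        using Suc.prems assms(1,2) by (simp only: swap r_null)
    qed (use assms(1) Suc.prems in simp)
    have y: "(x \<oplus> y) [^] (m + n') \<otimes> (y \<otimes> z) = \<zero>"
    proof (rule Suc.hyps(1))
      show "k = m + n'" using Suc.hyps(2) mn by simp
      show "y [^] n' \<otimes> (y \<otimes> z) = \<zero>"
        using Suc.prems mn assms(2) by (simp add: m_assoc)
      show "x [^] m \<otimes> (y \<otimes> z) = \<zero>"
        using Suc.prems assms(1,2) by (simp only: swap r_null)
    qed (use assms(2) Suc.prems in simp)
    let ?p = "(x \<oplus> y) [^] (m' + n)"
    have p: "?p \<in> carrier R" using assms by simp
    have "(x \<oplus> y) [^] (m + n) \<otimes> z = ?p \<otimes> ((x \<oplus> y) \<otimes> z)"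
      using assms(1,2) Suc.prems(1) mn by (simp add: m_assoc)
    also have "\<dots> = ?p \<otimes> (x \<otimes> z) \<oplus> ?p \<otimes> (y \<otimes> z)"
      using assms(1,2) Suc.prems(1) p by (simp add: l_distr r_distr)
    also have "\<dots> = \<zero>" using x y mn by simp
    finally show ?thesis .
  qed
qed

lemma nilpotent_zero: "nilpotent_element R \<zero>"
  by (auto simp: nilpotent_element_def intro!: exI[of _ 1])

lemma nilpotent_add:
  assumes "nilpotent_element R x" "nilpotent_element R y"
  shows "nilpotent_element R (x \<oplus> y)"
proof -
  obtain m n where "x \<in> carrier R" "y \<in> carrier R" "m > 0" "x [^] (m::nat) = \<zero>" "y [^] (n::nat) = \<zero>"
    using assms by (auto simp: nilpotent_element_def)
  then show ?thesis
    using sum_pow_annihilates[of x y \<one> m n] by (auto simp: nilpotent_element_def intro!: exI[of _ "m + n"])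
qed

lemma nilpotent_finsum:
  assumes "finite I" "\<And>i. i \<in> I \<Longrightarrow> nilpotent_element R (f i)"
  shows "nilpotent_element R (\<Oplus>i\<in>I. f i)"
  using assms
proof (induction I rule: finite_induct)
  case empty
  then show ?case by (simp add: nilpotent_zero)
next
  case (insert i I)
  then have "(\<Oplus>i\<in>insert i I. f i) = f i \<oplus> (\<Oplus>i\<in>I. f i)"
    by (intro finsum_insert) (auto simp: nilpotent_element_def)
  then show ?case using insert nilpotent_add by simp
qed

lemma nilpotent_mult:
  assumes "nilpotent_element R x" "y \<in> carrier R"
  shows "nilpotent_element R (x \<otimes> y)"
  using assms by (auto simp: nilpotent_element_def nat_pow_distrib)

end

section \<open>Subgroups\<close>

lemma (in group) subgroup_Union_chain:
  assumes "C \<noteq> {}" "\<And>H. H \<in> C \<Longrightarrow> subgroup H G" "\<And>H K. H \<in> C \<Longrightarrow> K \<in> C \<Longrightarrow> H \<subseteq> K \<or> K \<subseteq> H"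
  shows "subgroup (\<Union>C) G"
proof (rule subgroupI)
  show "\<Union>C \<subseteq> carrier G" using assms(2) by (auto dest: subgroup.subset)
  show "\<Union>C \<noteq> {}" using assms(1,2) by (auto dest: subgroup.one_closed)
  show "inv a \<in> \<Union>C" if "a \<in> \<Union>C" for a
    using that assms(2) by (auto intro: subgroup.m_inv_closed)
  show "a \<otimes> b \<in> \<Union>C" if ab: "a \<in> \<Union>C" "b \<in> \<Union>C" for a b
  proof -
    obtain H K where HK: "H \<in> C" "a \<in> H" "K \<in> C" "b \<in> K" using ab by blast
    then obtain M where "M \<in> C" "a \<in> M" "b \<in> M" using assms(3) by blast
    then show ?thesis using assms(2) by (auto intro: subgroup.m_closed)
  qed
qed

lemma (in group) subgroup_left_cancel:
  assumes "subgroup H G" "h \<in> H" "x \<in> carrier G" "h \<otimes> x \<in> H"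
  shows "x \<in> H"
proof -
  have "h \<in> carrier G" using assms(1,2) subgroup.subset by blast
  then have "inv h \<otimes> (h \<otimes> x) = x" using assms(3) by (simp add: m_assoc[symmetric])
  then show ?thesis using assms(1,2,4) by (metis subgroup.m_closed subgroup.m_inv_closed)
qed

lemma (in group) order_modulo_subgroup_exists:
  assumes "subgroup H G" "g \<in> carrier G" "ord g > 0"
  obtains m :: nat where "m > 0" "\<And>i. g [^] i \<in> H \<longleftrightarrow> m dvd i"
proof -
  define m where "m = (LEAST m::nat. m > 0 \<and> g [^] m \<in> H)"
  have "\<exists>m::nat. m > 0 \<and> g [^] m \<in> H"
    using assms pow_ord_eq_1[OF assms(2)] subgroup.one_closed[OF assms(1)] by (intro exI[of _ "ord g"]) auto
  then have m: "m > 0" "g [^] m \<in> H"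
    unfolding m_def by (metis (mono_tags, lifting) LeastI_ex)+
  have mult: "g [^] (m * k) \<in> H" for k :: nat
  proof -
    have "(g [^] m) [^] k \<in> H"
      using m(2) assms(1) by (induction k) (auto intro: subgroup.m_closed subgroup.one_closed)
    then show ?thesis using assms(2) by (simp add: nat_pow_pow)
  qed
  have "m dvd i" if i: "g [^] i \<in> H" for i :: nat
  proof -
    have "g [^] i = g [^] (m * (i div m)) \<otimes> g [^] (i mod m)"
      using assms(2) by (simp add: nat_pow_mult)
    then have "g [^] (i mod m) \<in> H"
      using subgroup_left_cancel[OF assms(1) mult[of "i div m"], of "g [^] (i mod m)"] i assms(2) by simp
    then have "i mod m = 0"
      using not_less_Least[of "i mod m" "\<lambda>m. m > 0 \<and> g [^] m \<in> H"] m(1) by (auto simp flip: m_def)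
    then show ?thesis by auto
  qed
  then show thesis using that m(1) mult by (auto elim: dvdE)
qed

section \<open>Twisting by a character\<close>

context twisted_group_algebra begin

text \<open>
  The graph of the linear map that sends \<open>u g\<close> to \<open>\<chi> g u g\<close> on the span of the \<open>u g\<close> with \<open>g \<in> H\<close>.
  As a relation generated from the basis it is seen to be additive and multiplicative without
  reference to coordinates; linear independence enters only to see that its value at zero is zero.
\<close>
inductive character_twist :: "'g set \<Rightarrow> ('g \<Rightarrow> 'k) \<Rightarrow> 'a \<Rightarrow> 'a \<Rightarrow> bool" for H \<chi> where
  zero: "character_twist H \<chi> \<zero>\<^bsub>A\<^esub> \<zero>\<^bsub>A\<^esub>"
| add: "\<lbrakk>a \<in> carrier K; g \<in> H; character_twist H \<chi> x y\<rbrakk> \<Longrightarrow>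
    character_twist H \<chi> (a \<odot>\<^bsub>A\<^esub> u g \<oplus>\<^bsub>A\<^esub> x) ((a \<otimes>\<^bsub>K\<^esub> \<chi> g) \<odot>\<^bsub>A\<^esub> u g \<oplus>\<^bsub>A\<^esub> y)"

lemma character_twist_combination:
  assumes "finite F" "F \<subseteq> H" "H \<subseteq> carrier G" "c \<in> F \<rightarrow> carrier K" "\<chi> \<in> H \<rightarrow> carrier K"
  shows "character_twist H \<chi> (\<Oplus>\<^bsub>A\<^esub>g\<in>F. c g \<odot>\<^bsub>A\<^esub> u g) (\<Oplus>\<^bsub>A\<^esub>g\<in>F. (c g \<otimes>\<^bsub>K\<^esub> \<chi> g) \<odot>\<^bsub>A\<^esub> u g)"
  using assms
proof (induction F rule: finite_induct)
  case empty
  then show ?case by (simp add: character_twist.zero)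
next
  case (insert g F)
  have "(\<Oplus>\<^bsub>A\<^esub>h\<in>insert g F. c h \<odot>\<^bsub>A\<^esub> u h) = c g \<odot>\<^bsub>A\<^esub> u g \<oplus>\<^bsub>A\<^esub> (\<Oplus>\<^bsub>A\<^esub>h\<in>F. c h \<odot>\<^bsub>A\<^esub> u h)"
    "(\<Oplus>\<^bsub>A\<^esub>h\<in>insert g F. (c h \<otimes>\<^bsub>K\<^esub> \<chi> h) \<odot>\<^bsub>A\<^esub> u h)
      = (c g \<otimes>\<^bsub>K\<^esub> \<chi> g) \<odot>\<^bsub>A\<^esub> u g \<oplus>\<^bsub>A\<^esub> (\<Oplus>\<^bsub>A\<^esub>h\<in>F. (c h \<otimes>\<^bsub>K\<^esub> \<chi> h) \<odot>\<^bsub>A\<^esub> u h)"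
    using insert by (auto intro!: M.finsum_insert simp: Pi_def subset_iff)
  then show ?case
    using insert by (auto intro!: character_twist.add)
qed

text \<open>
  The induction provides coefficients whose sum over every sufficiently large finite \<open>F\<close> is the given
  pair. In this form a new summand is added to one coefficient, whether or not its basis element has
  occurred before.
\<close>
lemma character_twist_normal_form:
  assumes "character_twist H \<chi> x y" "H \<subseteq> carrier G" "\<chi> \<in> H \<rightarrow> carrier K"
  obtains F c where "finite F" "F \<subseteq> H" "c \<in> F \<rightarrow> carrier K"
    "x = (\<Oplus>\<^bsub>A\<^esub>g\<in>F. c g \<odot>\<^bsub>A\<^esub> u g)" "y = (\<Oplus>\<^bsub>A\<^esub>g\<in>F. (c g \<otimes>\<^bsub>K\<^esub> \<chi> g) \<odot>\<^bsub>A\<^esub> u g)"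
proof -
  have "\<exists>F0 c. finite F0 \<and> F0 \<subseteq> H \<and> c \<in> H \<rightarrow> carrier K \<and>
    (\<forall>F. finite F \<and> F0 \<subseteq> F \<and> F \<subseteq> H \<longrightarrow> x = (\<Oplus>\<^bsub>A\<^esub>g\<in>F. c g \<odot>\<^bsub>A\<^esub> u g) \<and>
      y = (\<Oplus>\<^bsub>A\<^esub>g\<in>F. (c g \<otimes>\<^bsub>K\<^esub> \<chi> g) \<odot>\<^bsub>A\<^esub> u g))"
    using assms(1)
  proof induction
    case zero
    have "(\<Oplus>\<^bsub>A\<^esub>g\<in>F. (\<zero>\<^bsub>K\<^esub> \<otimes>\<^bsub>K\<^esub> \<psi> g) \<odot>\<^bsub>A\<^esub> u g) = \<zero>\<^bsub>A\<^esub>"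
      if "F \<subseteq> H" "\<psi> \<in> H \<rightarrow> carrier K" for F \<psi>
    proof -
      have "(\<zero>\<^bsub>K\<^esub> \<otimes>\<^bsub>K\<^esub> \<psi> g) \<odot>\<^bsub>A\<^esub> u g = \<zero>\<^bsub>A\<^esub>" if "g \<in> F" for g
        using that \<open>F \<subseteq> H\<close> \<open>\<psi> \<in> _\<close> assms(2) by (auto simp: Pi_def subset_iff)
      then have "(\<Oplus>\<^bsub>A\<^esub>g\<in>F. (\<zero>\<^bsub>K\<^esub> \<otimes>\<^bsub>K\<^esub> \<psi> g) \<odot>\<^bsub>A\<^esub> u g) = (\<Oplus>\<^bsub>A\<^esub>g\<in>F. \<zero>\<^bsub>A\<^esub>)"
        by (intro M.finsum_cong') auto
      then show ?thesis by simp
    qed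
    from this[OF _ assms(3)] this[of _ "\<lambda>_. \<one>\<^bsub>K\<^esub>"] show ?case
      by (intro exI[of _ "{}"] exI[of _ "\<lambda>_. \<zero>\<^bsub>K\<^esub>"]) auto
  next
    case (add a g x y)
    from add.IH obtain F0 c where c: "finite F0" "F0 \<subseteq> H" "c \<in> H \<rightarrow> carrier K"
      and xy: "\<forall>F. finite F \<and> F0 \<subseteq> F \<and> F \<subseteq> H \<longrightarrow> x = (\<Oplus>\<^bsub>A\<^esub>g\<in>F. c g \<odot>\<^bsub>A\<^esub> u g) \<and>
        y = (\<Oplus>\<^bsub>A\<^esub>g\<in>F. (c g \<otimes>\<^bsub>K\<^esub> \<chi> g) \<odot>\<^bsub>A\<^esub> u g)"
      by (elim exE conjE)
    have delta: "(\<Oplus>\<^bsub>A\<^esub>h\<in>F. (e h \<oplus>\<^bsub>K\<^esub> (if h = g then b else \<zero>\<^bsub>K\<^esub>)) \<odot>\<^bsub>A\<^esub> u h)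
        = b \<odot>\<^bsub>A\<^esub> u g \<oplus>\<^bsub>A\<^esub> (\<Oplus>\<^bsub>A\<^esub>h\<in>F. e h \<odot>\<^bsub>A\<^esub> u h)"
      if F: "finite F" "insert g F0 \<subseteq> F" "F \<subseteq> H" and e: "e \<in> H \<rightarrow> carrier K" "b \<in> carrier K" for F e b
    proof -
      have FG: "h \<in> carrier G" "e h \<in> carrier K" if "h \<in> F" for h
        using that F(3) assms(2) e by auto
      have "(\<Oplus>\<^bsub>A\<^esub>h\<in>F. (e h \<oplus>\<^bsub>K\<^esub> (if h = g then b else \<zero>\<^bsub>K\<^esub>)) \<odot>\<^bsub>A\<^esub> u h)
          = (\<Oplus>\<^bsub>A\<^esub>h\<in>F. (if h = g then b \<odot>\<^bsub>A\<^esub> u h else \<zero>\<^bsub>A\<^esub>) \<oplus>\<^bsub>A\<^esub> e h \<odot>\<^bsub>A\<^esub> u h)"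
        using FG e(2) by (intro M.finsum_cong') (auto simp: smult_l_distr M.a_comm)
      also have "\<dots> = (\<Oplus>\<^bsub>A\<^esub>h\<in>F. if h = g then b \<odot>\<^bsub>A\<^esub> u h else \<zero>\<^bsub>A\<^esub>) \<oplus>\<^bsub>A\<^esub> (\<Oplus>\<^bsub>A\<^esub>h\<in>F. e h \<odot>\<^bsub>A\<^esub> u h)"
        using FG e(2) by (intro M.finsum_addf) auto
      also have "(\<Oplus>\<^bsub>A\<^esub>h\<in>F. if h = g then b \<odot>\<^bsub>A\<^esub> u h else \<zero>\<^bsub>A\<^esub>) = b \<odot>\<^bsub>A\<^esub> u g"
        using F FG e(2) by (intro M.add.finprod_singleton_swap) auto
      finally show ?thesis .
    qed
    define c' where "c' h = c h \<oplus>\<^bsub>K\<^esub> (if h = g then a else \<zero>\<^bsub>K\<^esub>)" for h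
    have \<chi>g: "\<chi> g \<in> carrier K" using add.hyps(2) assms(3) by auto
    have c': "c' \<in> H \<rightarrow> carrier K" using c(3) add.hyps(1) by (auto simp: c'_def Pi_def)
    have "a \<odot>\<^bsub>A\<^esub> u g \<oplus>\<^bsub>A\<^esub> x = (\<Oplus>\<^bsub>A\<^esub>h\<in>F. c' h \<odot>\<^bsub>A\<^esub> u h)"
      "(a \<otimes>\<^bsub>K\<^esub> \<chi> g) \<odot>\<^bsub>A\<^esub> u g \<oplus>\<^bsub>A\<^esub> y = (\<Oplus>\<^bsub>A\<^esub>h\<in>F. (c' h \<otimes>\<^bsub>K\<^esub> \<chi> h) \<odot>\<^bsub>A\<^esub> u h)"
      if F: "finite F" "insert g F0 \<subseteq> F" "F \<subseteq> H" for F
    proof -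
      show "a \<odot>\<^bsub>A\<^esub> u g \<oplus>\<^bsub>A\<^esub> x = (\<Oplus>\<^bsub>A\<^esub>h\<in>F. c' h \<odot>\<^bsub>A\<^esub> u h)"
        using delta[OF F c(3) add.hyps(1)] xy[rule_format, of F] F by (simp add: c'_def)
      have "(\<Oplus>\<^bsub>A\<^esub>h\<in>F. (c' h \<otimes>\<^bsub>K\<^esub> \<chi> h) \<odot>\<^bsub>A\<^esub> u h)
          = (\<Oplus>\<^bsub>A\<^esub>h\<in>F. (c h \<otimes>\<^bsub>K\<^esub> \<chi> h \<oplus>\<^bsub>K\<^esub> (if h = g then a \<otimes>\<^bsub>K\<^esub> \<chi> g else \<zero>\<^bsub>K\<^esub>)) \<odot>\<^bsub>A\<^esub> u h)"
      proof (intro M.finsum_cong')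
        fix h assume "h \<in> F"
        then have h: "c h \<in> carrier K" "\<chi> h \<in> carrier K" "h \<in> carrier G"
          using F(3) c(3) assms(2,3) by auto
        then show "(c' h \<otimes>\<^bsub>K\<^esub> \<chi> h) \<odot>\<^bsub>A\<^esub> u h
            = (c h \<otimes>\<^bsub>K\<^esub> \<chi> h \<oplus>\<^bsub>K\<^esub> (if h = g then a \<otimes>\<^bsub>K\<^esub> \<chi> g else \<zero>\<^bsub>K\<^esub>)) \<odot>\<^bsub>A\<^esub> u h"
          using add.hyps(1) by (simp add: c'_def K.l_distr)
      qed (use F(3) c(3) assms(2,3) add.hyps(1) \<chi>g in \<open>auto simp: Pi_def subset_iff\<close>)
      also have "\<dots> = (a \<otimes>\<^bsub>K\<^esub> \<chi> g) \<odot>\<^bsub>A\<^esub> u g \<oplus>\<^bsub>A\<^esub> y"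
        using delta[OF F, of "\<lambda>h. c h \<otimes>\<^bsub>K\<^esub> \<chi> h" "a \<otimes>\<^bsub>K\<^esub> \<chi> g"] xy[rule_format, of F] F c(3) assms(3) add.hyps(1) \<chi>g
        by (simp add: Pi_def)
      finally show "(a \<otimes>\<^bsub>K\<^esub> \<chi> g) \<odot>\<^bsub>A\<^esub> u g \<oplus>\<^bsub>A\<^esub> y = (\<Oplus>\<^bsub>A\<^esub>h\<in>F. (c' h \<otimes>\<^bsub>K\<^esub> \<chi> h) \<odot>\<^bsub>A\<^esub> u h)" ..
    qed
    then show ?case
      using c(1,2) c' add.hyps(2)
      by (intro exI[of _ "insert g F0"] exI[of _ c']) auto
  qed
  then obtain F c where "finite F" "F \<subseteq> H" and c: "c \<in> H \<rightarrow> carrier K"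
    and xy: "\<forall>F'. finite F' \<and> F \<subseteq> F' \<and> F' \<subseteq> H \<longrightarrow> x = (\<Oplus>\<^bsub>A\<^esub>g\<in>F'. c g \<odot>\<^bsub>A\<^esub> u g) \<and>
      y = (\<Oplus>\<^bsub>A\<^esub>g\<in>F'. (c g \<otimes>\<^bsub>K\<^esub> \<chi> g) \<odot>\<^bsub>A\<^esub> u g)"
    by (elim exE conjE)
  moreover have "c \<in> F \<rightarrow> carrier K" using c \<open>F \<subseteq> H\<close> by blast
  ultimately show thesis using that[of F c] xy[rule_format, of F] by blast
qed

lemma character_twist_zero:
  assumes "character_twist H \<chi> \<zero>\<^bsub>A\<^esub> y" "H \<subseteq> carrier G" "\<chi> \<in> H \<rightarrow> carrier K"
  shows "y = \<zero>\<^bsub>A\<^esub>"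
proof -
  obtain F c where Fc: "finite F" "F \<subseteq> H" "c \<in> F \<rightarrow> carrier K"
    "\<zero>\<^bsub>A\<^esub> = (\<Oplus>\<^bsub>A\<^esub>g\<in>F. c g \<odot>\<^bsub>A\<^esub> u g)" "y = (\<Oplus>\<^bsub>A\<^esub>g\<in>F. (c g \<otimes>\<^bsub>K\<^esub> \<chi> g) \<odot>\<^bsub>A\<^esub> u g)"
    using assms by (rule character_twist_normal_form)
  have "c g = \<zero>\<^bsub>K\<^esub>" if "g \<in> F" for g
    using independent_reindexed[of F "\<lambda>g. g" c g] Fc assms(2) that by auto
  then have "y = (\<Oplus>\<^bsub>A\<^esub>g\<in>F. \<zero>\<^bsub>A\<^esub>)"
    unfolding Fc(5) using Fc(2) assms(2,3) by (intro M.finsum_cong') (auto simp: Pi_def subset_iff)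
  then show ?thesis by simp
qed

lemma character_twist_closed:
  assumes "character_twist H \<chi> x y" "H \<subseteq> carrier G" "\<chi> \<in> H \<rightarrow> carrier K"
  shows "x \<in> carrier A" "y \<in> carrier A"
  using assms(1) by induction (use assms(2,3) in \<open>auto simp: Pi_def subset_iff\<close>)

lemma character_twist_add:
  assumes "character_twist H \<chi> x y" "character_twist H \<chi> x' y'"
    and H: "H \<subseteq> carrier G" "\<chi> \<in> H \<rightarrow> carrier K"
  shows "character_twist H \<chi> (x \<oplus>\<^bsub>A\<^esub> x') (y \<oplus>\<^bsub>A\<^esub> y')"
  using assms(1)
proof induction
  case zero
  then show ?case using assms(2) character_twist_closed[OF assms(2) H] by simp
next
  case (add a g x y)
  have "g \<in> carrier G" "\<chi> g \<in> carrier K" using add.hyps(2) H by auto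
  then show ?case
    using character_twist.add[OF add.hyps(1,2) add.IH] add.hyps(1)
      character_twist_closed[OF add.hyps(3) H] character_twist_closed[OF assms(2) H]
    by (simp add: M.a_assoc)
qed

lemma scaled_basis_mult:
  assumes "a \<in> carrier K" "b \<in> carrier K" "g \<in> carrier G" "h \<in> carrier G"
  shows "(a \<odot>\<^bsub>A\<^esub> u g) \<otimes>\<^bsub>A\<^esub> (b \<odot>\<^bsub>A\<^esub> u h) = ((a \<otimes>\<^bsub>K\<^esub> b) \<otimes>\<^bsub>K\<^esub> \<rho> g h) \<odot>\<^bsub>A\<^esub> u (g \<otimes>\<^bsub>G\<^esub> h)"
  using assms by (simp add: smult_mult_left smult_mult_right basis_mult K.m_ac flip: smult_assoc1)

lemma character_twist_mult_basis:
  assumes "character_twist H \<chi> x y" "a \<in> carrier K" "g \<in> H"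
    and H: "subgroup H G" "\<chi> \<in> H \<rightarrow> carrier K"
    and mult: "\<And>g h. \<lbrakk>g \<in> H; h \<in> H\<rbrakk> \<Longrightarrow> \<chi> (g \<otimes>\<^bsub>G\<^esub> h) = \<chi> g \<otimes>\<^bsub>K\<^esub> \<chi> h"
  shows "character_twist H \<chi> ((a \<odot>\<^bsub>A\<^esub> u g) \<otimes>\<^bsub>A\<^esub> x) (((a \<otimes>\<^bsub>K\<^esub> \<chi> g) \<odot>\<^bsub>A\<^esub> u g) \<otimes>\<^bsub>A\<^esub> y)"
  using assms(1)
proof induction
  have HG: "H \<subseteq> carrier G" using H(1) by (rule subgroup.subset)
  have g: "g \<in> carrier G" "\<chi> g \<in> carrier K" using assms(3) HG H(2) by auto
  {
    case zero
    then show ?case using assms(2) g by (simp add: character_twist.zero)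
  next
    case (add b h x y)
    have h: "h \<in> carrier G" "\<chi> h \<in> carrier K" using add.hyps(2) HG H(2) by auto
    have gh: "g \<otimes>\<^bsub>G\<^esub> h \<in> H" using H(1) assms(3) add.hyps(2) by (rule subgroup.m_closed)
    let ?r = "(a \<otimes>\<^bsub>K\<^esub> b) \<otimes>\<^bsub>K\<^esub> \<rho> g h"
    have r: "?r \<in> carrier K" using assms(2) add.hyps(1) g h by simp
    have xy: "x \<in> carrier A" "y \<in> carrier A"
      using character_twist_closed[OF add.hyps(3) HG H(2)] by auto
    have "(a \<odot>\<^bsub>A\<^esub> u g) \<otimes>\<^bsub>A\<^esub> (b \<odot>\<^bsub>A\<^esub> u h \<oplus>\<^bsub>A\<^esub> x) = ?r \<odot>\<^bsub>A\<^esub> u (g \<otimes>\<^bsub>G\<^esub> h) \<oplus>\<^bsub>A\<^esub> (a \<odot>\<^bsub>A\<^esub> u g) \<otimes>\<^bsub>A\<^esub> x"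
      using assms(2) add.hyps(1) g h xy by (simp add: A.r_distr scaled_basis_mult)
    moreover have "((a \<otimes>\<^bsub>K\<^esub> \<chi> g) \<odot>\<^bsub>A\<^esub> u g) \<otimes>\<^bsub>A\<^esub> ((b \<otimes>\<^bsub>K\<^esub> \<chi> h) \<odot>\<^bsub>A\<^esub> u h \<oplus>\<^bsub>A\<^esub> y)
        = (?r \<otimes>\<^bsub>K\<^esub> \<chi> (g \<otimes>\<^bsub>G\<^esub> h)) \<odot>\<^bsub>A\<^esub> u (g \<otimes>\<^bsub>G\<^esub> h) \<oplus>\<^bsub>A\<^esub> ((a \<otimes>\<^bsub>K\<^esub> \<chi> g) \<odot>\<^bsub>A\<^esub> u g) \<otimes>\<^bsub>A\<^esub> y"
    proof -
      have "?r \<otimes>\<^bsub>K\<^esub> \<chi> (g \<otimes>\<^bsub>G\<^esub> h) = ((a \<otimes>\<^bsub>K\<^esub> \<chi> g) \<otimes>\<^bsub>K\<^esub> (b \<otimes>\<^bsub>K\<^esub> \<chi> h)) \<otimes>\<^bsub>K\<^esub> \<rho> g h"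
        using mult[OF assms(3) add.hyps(2)] assms(2) add.hyps(1) g h by (simp add: K.m_ac)
      then show ?thesis
        using assms(2) add.hyps(1) g h xy by (simp add: A.r_distr scaled_basis_mult)
    qed
    ultimately show ?case using character_twist.add[OF r gh add.IH] by simp
  }
qed

lemma character_twist_mult:
  assumes "character_twist H \<chi> x y" "character_twist H \<chi> x' y'"
    and H: "subgroup H G" "\<chi> \<in> H \<rightarrow> carrier K"
    and mult: "\<And>g h. \<lbrakk>g \<in> H; h \<in> H\<rbrakk> \<Longrightarrow> \<chi> (g \<otimes>\<^bsub>G\<^esub> h) = \<chi> g \<otimes>\<^bsub>K\<^esub> \<chi> h"
  shows "character_twist H \<chi> (x \<otimes>\<^bsub>A\<^esub> x') (y \<otimes>\<^bsub>A\<^esub> y')"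
  using assms(1)
proof induction
  have HG: "H \<subseteq> carrier G" using H(1) by (rule subgroup.subset)
  have xy': "x' \<in> carrier A" "y' \<in> carrier A"
    using character_twist_closed[OF assms(2) HG H(2)] by auto
  {
    case zero
    then show ?case using xy' by (simp add: character_twist.zero)
  next
    case (add a g x y)
    have "g \<in> carrier G" "\<chi> g \<in> carrier K" using add.hyps(2) HG H(2) by auto
    then show ?case
      using character_twist_add[OF character_twist_mult_basis[OF assms(2) add.hyps(1,2) H mult] add.IH HG H(2)]
        character_twist_closed[OF add.hyps(3) HG H(2)] xy' add.hyps(1)
      by (simp add: A.l_distr)
  }
qed

lemma character_twist_pow:
  assumes "character_twist H \<chi> x y"
    and H: "subgroup H G" "\<chi> \<in> H \<rightarrow> carrier K" "\<chi> \<one>\<^bsub>G\<^esub> = \<one>\<^bsub>K\<^esub>"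
    and mult: "\<And>g h. \<lbrakk>g \<in> H; h \<in> H\<rbrakk> \<Longrightarrow> \<chi> (g \<otimes>\<^bsub>G\<^esub> h) = \<chi> g \<otimes>\<^bsub>K\<^esub> \<chi> h"
  shows "character_twist H \<chi> (x [^]\<^bsub>A\<^esub> n) (y [^]\<^bsub>A\<^esub> (n::nat))"
proof (induction n)
  case 0
  have "character_twist H \<chi> (\<one>\<^bsub>K\<^esub> \<odot>\<^bsub>A\<^esub> u \<one>\<^bsub>G\<^esub> \<oplus>\<^bsub>A\<^esub> \<zero>\<^bsub>A\<^esub>) ((\<one>\<^bsub>K\<^esub> \<otimes>\<^bsub>K\<^esub> \<chi> \<one>\<^bsub>G\<^esub>) \<odot>\<^bsub>A\<^esub> u \<one>\<^bsub>G\<^esub> \<oplus>\<^bsub>A\<^esub> \<zero>\<^bsub>A\<^esub>)"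
    using subgroup.one_closed[OF H(1)] by (intro character_twist.intros) auto
  then show ?case using H(3) by (simp add: basis_one)
next
  case (Suc n)
  then show ?case using character_twist_mult[OF Suc assms(1) H(1,2) mult] by simp
qed

text \<open>
  If \<open>\<chi>\<close> is a character, the twist is an algebra homomorphism, so it preserves nilpotency.
\<close>
lemma character_twist_nilpotent:
  assumes "character_twist H \<chi> x y" "nilpotent_element A x"
    and H: "subgroup H G" "\<chi> \<in> H \<rightarrow> carrier K" "\<chi> \<one>\<^bsub>G\<^esub> = \<one>\<^bsub>K\<^esub>"
    and mult: "\<And>g h. \<lbrakk>g \<in> H; h \<in> H\<rbrakk> \<Longrightarrow> \<chi> (g \<otimes>\<^bsub>G\<^esub> h) = \<chi> g \<otimes>\<^bsub>K\<^esub> \<chi> h"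
  shows "nilpotent_element A y"
proof -
  have HG: "H \<subseteq> carrier G" using H(1) by (rule subgroup.subset)
  obtain n :: nat where "n > 0" "x [^]\<^bsub>A\<^esub> n = \<zero>\<^bsub>A\<^esub>"
    using assms(2) by (auto simp: nilpotent_element_def)
  moreover have "character_twist H \<chi> (x [^]\<^bsub>A\<^esub> n) (y [^]\<^bsub>A\<^esub> n)"
    using assms(1) H mult by (rule character_twist_pow)
  ultimately show ?thesis
    using character_twist_zero[OF _ HG H(2)] character_twist_closed(2)[OF assms(1) HG H(2)]
    by (auto simp: nilpotent_element_def)
qed

section \<open>The trace of nilpotent elements\<close>

text \<open>
  The coefficient at \<open>\<one>\<close> is the natural trace of a twisted group algebra. If the
  algebra is commutative and \<open>H\<close> is a subgroup, the property is equivalent to the absence of nonzero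
  nilpotent elements in the span of the \<open>u h\<close> with \<open>h \<in> H\<close>, but a statement about one coefficient is easier
  to pass from one subgroup to the next.
\<close>
definition nilpotents_traceless_on :: "'g set \<Rightarrow> bool" where
  "nilpotents_traceless_on H \<longleftrightarrow>
    (\<forall>F c. finite F \<and> F \<subseteq> H \<and> c \<in> F \<rightarrow> carrier K \<and> \<one>\<^bsub>G\<^esub> \<in> F \<and>
      nilpotent_element A (\<Oplus>\<^bsub>A\<^esub>g\<in>F. c g \<odot>\<^bsub>A\<^esub> u g) \<longrightarrow> c \<one>\<^bsub>G\<^esub> = \<zero>\<^bsub>K\<^esub>)"

lemma nilpotents_traceless_on_trivial: "nilpotents_traceless_on {\<one>\<^bsub>G\<^esub>}"
  unfolding nilpotents_traceless_on_def
proof (intro allI impI, elim conjE)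
  fix F c
  assume F: "F \<subseteq> {\<one>\<^bsub>G\<^esub>}" "\<one>\<^bsub>G\<^esub> \<in> F" and c: "c \<in> F \<rightarrow> carrier K"
    and nil: "nilpotent_element A (\<Oplus>\<^bsub>A\<^esub>g\<in>F. c g \<odot>\<^bsub>A\<^esub> u g)"
  let ?c = "c \<one>\<^bsub>G\<^esub>"
  have F1: "F = {\<one>\<^bsub>G\<^esub>}" using F by blast
  have cK: "?c \<in> carrier K" using c F by blast
  have "(\<Oplus>\<^bsub>A\<^esub>g\<in>F. c g \<odot>\<^bsub>A\<^esub> u g) = ?c \<odot>\<^bsub>A\<^esub> \<one>\<^bsub>A\<^esub>"
    using cK by (simp add: F1 basis_one)
  then obtain n :: nat where "(?c \<odot>\<^bsub>A\<^esub> \<one>\<^bsub>A\<^esub>) [^]\<^bsub>A\<^esub> n = \<zero>\<^bsub>A\<^esub>"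
    using nil by (auto simp: nilpotent_element_def)
  then have "(?c [^]\<^bsub>K\<^esub> n) \<odot>\<^bsub>A\<^esub> u \<one>\<^bsub>G\<^esub> = \<zero>\<^bsub>K\<^esub> \<odot>\<^bsub>A\<^esub> u \<one>\<^bsub>G\<^esub>"
    using cK by (simp add: smult_pow basis_one)
  then have "?c [^]\<^bsub>K\<^esub> n = \<zero>\<^bsub>K\<^esub>"
    using scaled_basis_eqD(2)[of "?c [^]\<^bsub>K\<^esub> n" "\<zero>\<^bsub>K\<^esub>" "\<one>\<^bsub>G\<^esub>" "\<one>\<^bsub>G\<^esub>"] cK by auto
  then show "?c = \<zero>\<^bsub>K\<^esub>"
  proof (induction n)
    case (Suc n)
    then show ?case using cK by (auto simp: K.integral_iff)
  qed simp
qed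

text \<open>
  The twists of a nilpotent element by the powers of \<open>\<chi>\<close> are nilpotent, and so is their sum in a
  commutative ring. By orthogonality this sum is \<open>m\<close> times the part of the element that is supported on
  \<open>H\<close>; it has the same coefficient at \<open>\<one>\<close>, up to the factor \<open>m\<close>.
\<close>
lemma nilpotents_traceless_on_extend:
  assumes "cring A" "nilpotents_traceless_on H" "\<one>\<^bsub>G\<^esub> \<in> H" "H \<subseteq> L" "subgroup L G"
    and \<chi>: "\<chi> \<in> L \<rightarrow> carrier K" "\<chi> \<one>\<^bsub>G\<^esub> = \<one>\<^bsub>K\<^esub>"
      "\<And>g h. \<lbrakk>g \<in> L; h \<in> L\<rbrakk> \<Longrightarrow> \<chi> (g \<otimes>\<^bsub>G\<^esub> h) = \<chi> g \<otimes>\<^bsub>K\<^esub> \<chi> h"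
    and sum: "\<And>l. l \<in> L \<Longrightarrow> (\<Oplus>\<^bsub>K\<^esub>k\<in>{..<m}. \<chi> l [^]\<^bsub>K\<^esub> k) = (if l \<in> H then [m] \<cdot>\<^bsub>K\<^esub> \<one>\<^bsub>K\<^esub> else \<zero>\<^bsub>K\<^esub>)"
    and m: "[(m::nat)] \<cdot>\<^bsub>K\<^esub> \<one>\<^bsub>K\<^esub> \<noteq> \<zero>\<^bsub>K\<^esub>"
  shows "nilpotents_traceless_on L"
  unfolding nilpotents_traceless_on_def
proof (intro allI impI, elim conjE)
  interpret A: cring A by fact
  fix F c
  assume F: "finite F" "F \<subseteq> L" "\<one>\<^bsub>G\<^esub> \<in> F" and c: "c \<in> F \<rightarrow> carrier K"
    and nil: "nilpotent_element A (\<Oplus>\<^bsub>A\<^esub>g\<in>F. c g \<odot>\<^bsub>A\<^esub> u g)"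
  have LG: "L \<subseteq> carrier G" using assms(5) by (rule subgroup.subset)
  have gF: "g \<in> carrier G" "c g \<in> carrier K" "\<chi> g \<in> carrier K" if "g \<in> F" for g
    using that F LG c \<chi>(1) by auto
  let ?y = "\<lambda>k. \<Oplus>\<^bsub>A\<^esub>g\<in>F. (c g \<otimes>\<^bsub>K\<^esub> (\<chi> g [^]\<^bsub>K\<^esub> (k::nat))) \<odot>\<^bsub>A\<^esub> u g"
  have "nilpotent_element A (?y k)" for k
  proof (rule character_twist_nilpotent[OF _ nil assms(5)])
    show \<chi>k: "(\<lambda>g. \<chi> g [^]\<^bsub>K\<^esub> k) \<in> L \<rightarrow> carrier K" using \<chi>(1) by auto
    show "character_twist L (\<lambda>g. \<chi> g [^]\<^bsub>K\<^esub> k) (\<Oplus>\<^bsub>A\<^esub>g\<in>F. c g \<odot>\<^bsub>A\<^esub> u g) (?y k)"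
      using F c LG \<chi>k by (intro character_twist_combination) auto
    show "\<chi> \<one>\<^bsub>G\<^esub> [^]\<^bsub>K\<^esub> k = \<one>\<^bsub>K\<^esub>" using \<chi>(2) by simp
    show "\<chi> (g \<otimes>\<^bsub>G\<^esub> h) [^]\<^bsub>K\<^esub> k = \<chi> g [^]\<^bsub>K\<^esub> k \<otimes>\<^bsub>K\<^esub> \<chi> h [^]\<^bsub>K\<^esub> k" if "g \<in> L" "h \<in> L" for g h
      using that \<chi>(1) \<chi>(3)[OF that] by (auto simp: Pi_def K.nat_pow_distrib)
  qed
  then have nil_sum: "nilpotent_element A (\<Oplus>\<^bsub>A\<^esub>k\<in>{..<m}. ?y k)"
    by (intro A.nilpotent_finsum[OF finite_lessThan])
  have "(\<Oplus>\<^bsub>A\<^esub>k\<in>{..<m}. ?y k)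
      = (\<Oplus>\<^bsub>A\<^esub>g\<in>F. \<Oplus>\<^bsub>A\<^esub>k\<in>{..<m}. (c g \<otimes>\<^bsub>K\<^esub> (\<chi> g [^]\<^bsub>K\<^esub> k)) \<odot>\<^bsub>A\<^esub> u g)"
    using F(1) gF by (intro M.finsum_swap) auto
  also have "\<dots> = (\<Oplus>\<^bsub>A\<^esub>g\<in>F. (c g \<otimes>\<^bsub>K\<^esub> (\<Oplus>\<^bsub>K\<^esub>k\<in>{..<m}. \<chi> g [^]\<^bsub>K\<^esub> k)) \<odot>\<^bsub>A\<^esub> u g)"
  proof (intro M.finsum_cong')
    fix g assume g: "g \<in> F"
    have "c g \<otimes>\<^bsub>K\<^esub> (\<Oplus>\<^bsub>K\<^esub>k\<in>{..<m}. \<chi> g [^]\<^bsub>K\<^esub> k) = (\<Oplus>\<^bsub>K\<^esub>k\<in>{..<m}. c g \<otimes>\<^bsub>K\<^esub> \<chi> g [^]\<^bsub>K\<^esub> k)"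
      using gF[OF g] by (intro K.finsum_rdistr) auto
    then show "(\<Oplus>\<^bsub>A\<^esub>k\<in>{..<m}. (c g \<otimes>\<^bsub>K\<^esub> (\<chi> g [^]\<^bsub>K\<^esub> k)) \<odot>\<^bsub>A\<^esub> u g)
        = (c g \<otimes>\<^bsub>K\<^esub> (\<Oplus>\<^bsub>K\<^esub>k\<in>{..<m}. \<chi> g [^]\<^bsub>K\<^esub> k)) \<odot>\<^bsub>A\<^esub> u g"
      using gF[OF g] by (simp add: finsum_smult_rdistr Pi_def)
  qed (use gF in \<open>auto simp: Pi_def\<close>)
  also have "\<dots> = (\<Oplus>\<^bsub>A\<^esub>g\<in>F \<inter> H. (c g \<otimes>\<^bsub>K\<^esub> ([m] \<cdot>\<^bsub>K\<^esub> \<one>\<^bsub>K\<^esub>)) \<odot>\<^bsub>A\<^esub> u g)"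
    using F gF sum by (intro M.add.finprod_mono_neutral_cong_right) (auto simp: subset_iff)
  finally have nil_H: "nilpotent_element A (\<Oplus>\<^bsub>A\<^esub>g\<in>F \<inter> H. (c g \<otimes>\<^bsub>K\<^esub> ([m] \<cdot>\<^bsub>K\<^esub> \<one>\<^bsub>K\<^esub>)) \<odot>\<^bsub>A\<^esub> u g)"
    using nil_sum by simp
  have coeff: "(\<lambda>g. c g \<otimes>\<^bsub>K\<^esub> ([m] \<cdot>\<^bsub>K\<^esub> \<one>\<^bsub>K\<^esub>)) \<in> F \<inter> H \<rightarrow> carrier K" using gF by auto
  have "c \<one>\<^bsub>G\<^esub> \<otimes>\<^bsub>K\<^esub> ([m] \<cdot>\<^bsub>K\<^esub> \<one>\<^bsub>K\<^esub>) = \<zero>\<^bsub>K\<^esub>"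
    using assms(2)[unfolded nilpotents_traceless_on_def, rule_format,
        of "F \<inter> H" "\<lambda>g. c g \<otimes>\<^bsub>K\<^esub> ([m] \<cdot>\<^bsub>K\<^esub> \<one>\<^bsub>K\<^esub>)"] nil_H coeff F assms(3) by blast
  then show "c \<one>\<^bsub>G\<^esub> = \<zero>\<^bsub>K\<^esub>" using m gF(2)[OF F(3)] by (auto simp: K.integral_iff)
qed

lemma commutative_algebra:
  assumes "comm_group G" "symmetric_factor_system G \<rho>"
  shows "cring A"
proof
  fix x y assume x: "x \<in> carrier A" and y: "y \<in> carrier A"
  have "u g \<otimes>\<^bsub>A\<^esub> u h = u h \<otimes>\<^bsub>A\<^esub> u g" if "g \<in> carrier G" "h \<in> carrier G" for g h
  proof -
    have "g \<otimes>\<^bsub>G\<^esub> h = h \<otimes>\<^bsub>G\<^esub> g"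
      using that comm_group.axioms(1)[OF assms(1)] by (rule_tac comm_monoid.m_comm)
    then show ?thesis
      using that assms(2) by (simp add: symmetric_factor_system_def basis_mult)
  qed
  then have "u g \<otimes>\<^bsub>A\<^esub> z = z \<otimes>\<^bsub>A\<^esub> u g" if "g \<in> carrier G" "z \<in> carrier A" for g z
    using that commute_basis_imp_central[of "u g" z] by simp
  then show "x \<otimes>\<^bsub>A\<^esub> y = y \<otimes>\<^bsub>A\<^esub> x"
    using commute_basis_imp_central[OF y, of x] x y by simp
qed

text \<open>
  The quotient of \<open>L = H\<langle>g\<rangle>\<close> by \<open>H\<close> is cyclic of some order \<open>m\<close>, which divides the order of \<open>g\<close> and
  is therefore invertible. It has a character of order \<open>m\<close>: if \<open>l g\<^sup>i\<close> lies in \<open>H\<close>, send \<open>l\<close> to \<open>z\<^sup>i\<close> for a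
  primitive \<open>m\<close>-th root of unity \<open>z\<close>.
\<close>
lemma nilpotents_traceless_on_adjoin:
  assumes "algebraically_closed K" "comm_group G" "cring A"
    and H: "subgroup H G" "nilpotents_traceless_on H"
    and g: "g \<in> carrier G" "G.ord g > 0" "[G.ord g] \<cdot>\<^bsub>K\<^esub> \<one>\<^bsub>K\<^esub> \<noteq> \<zero>\<^bsub>K\<^esub>"
  obtains L where "subgroup L G" "H \<subseteq> L" "g \<in> L" "nilpotents_traceless_on L"
proof -
  interpret K: algebraically_closed K by fact
  interpret G: comm_group G by fact
  have HG: "H \<subseteq> carrier G" using H(1) by (rule subgroup.subset)
  obtain m :: nat where m: "m > 0" "\<And>i. g [^]\<^bsub>G\<^esub> i \<in> H \<longleftrightarrow> m dvd i"
    using G.order_modulo_subgroup_exists[OF H(1) g(1,2)] by blast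
  have m_inv: "[m] \<cdot>\<^bsub>K\<^esub> \<one>\<^bsub>K\<^esub> \<noteq> \<zero>\<^bsub>K\<^esub>"
  proof
    assume zero: "[m] \<cdot>\<^bsub>K\<^esub> \<one>\<^bsub>K\<^esub> = \<zero>\<^bsub>K\<^esub>"
    have "m dvd G.ord g"
      using m(2)[of "G.ord g"] G.pow_ord_eq_1[OF g(1)] subgroup.one_closed[OF H(1)] by simp
    then obtain k where "G.ord g = m * k" by (rule dvdE)
    then have "[G.ord g] \<cdot>\<^bsub>K\<^esub> \<one>\<^bsub>K\<^esub> = [k] \<cdot>\<^bsub>K\<^esub> ([m] \<cdot>\<^bsub>K\<^esub> \<one>\<^bsub>K\<^esub>)"
      by (simp add: K.add.nat_pow_pow)
    then show False using g(3) zero by simp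
  qed
  obtain z where z: "z \<in> carrier K" "\<And>j::nat. z [^]\<^bsub>K\<^esub> j = \<one>\<^bsub>K\<^esub> \<longleftrightarrow> m dvd j"
    using K.primitive_root_of_unity_exists[OF m_inv] by blast
  \<comment> \<open>Natural exponents suffice because \<open>g\<close> has finite order.\<close>
  define L where "L = {l \<in> carrier G. \<exists>i::nat. l \<otimes>\<^bsub>G\<^esub> g [^]\<^bsub>G\<^esub> i \<in> H}"
  define \<chi> where "\<chi> l = z [^]\<^bsub>K\<^esub> (SOME i::nat. l \<otimes>\<^bsub>G\<^esub> g [^]\<^bsub>G\<^esub> i \<in> H)" for l
  have unique: "z [^]\<^bsub>K\<^esub> i = z [^]\<^bsub>K\<^esub> j"
    if "l \<in> carrier G" "l \<otimes>\<^bsub>G\<^esub> g [^]\<^bsub>G\<^esub> i \<in> H" "l \<otimes>\<^bsub>G\<^esub> g [^]\<^bsub>G\<^esub> j \<in> H" for l and i j :: nat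
    using that
  proof (induction i j rule: linorder_wlog)
    case (le i j)
    have "l \<otimes>\<^bsub>G\<^esub> g [^]\<^bsub>G\<^esub> i \<otimes>\<^bsub>G\<^esub> g [^]\<^bsub>G\<^esub> (j - i) = l \<otimes>\<^bsub>G\<^esub> g [^]\<^bsub>G\<^esub> j"
      using le g(1) by (simp add: G.m_assoc G.nat_pow_mult)
    then have "g [^]\<^bsub>G\<^esub> (j - i) \<in> H"
      using G.subgroup_left_cancel[OF H(1) le(3), of "g [^]\<^bsub>G\<^esub> (j - i)"] le(4) g(1) by simp
    then have "z [^]\<^bsub>K\<^esub> (j - i) = \<one>\<^bsub>K\<^esub>" using m(2) z(2) by blast
    moreover have "z [^]\<^bsub>K\<^esub> i \<otimes>\<^bsub>K\<^esub> z [^]\<^bsub>K\<^esub> (j - i) = z [^]\<^bsub>K\<^esub> j"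
      using le(1) z(1) by (simp add: K.nat_pow_mult)
    ultimately show ?case using z(1) by simp
  next
    case (sym i j)
    then show ?case by simp
  qed
  have \<chi>_eq: "\<chi> l = z [^]\<^bsub>K\<^esub> i" if "l \<in> carrier G" "l \<otimes>\<^bsub>G\<^esub> g [^]\<^bsub>G\<^esub> i \<in> H" for l and i :: nat
  proof -
    have "l \<otimes>\<^bsub>G\<^esub> g [^]\<^bsub>G\<^esub> (SOME i::nat. l \<otimes>\<^bsub>G\<^esub> g [^]\<^bsub>G\<^esub> i \<in> H) \<in> H"
      using that(2) by (rule someI)
    then show ?thesis unfolding \<chi>_def using unique that by blast
  qed
  have prod: "(l \<otimes>\<^bsub>G\<^esub> l') \<otimes>\<^bsub>G\<^esub> g [^]\<^bsub>G\<^esub> (i + j) \<in> H"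
    if "l \<in> carrier G" "l' \<in> carrier G" "l \<otimes>\<^bsub>G\<^esub> g [^]\<^bsub>G\<^esub> i \<in> H" "l' \<otimes>\<^bsub>G\<^esub> g [^]\<^bsub>G\<^esub> j \<in> H" for l l' and i j :: nat
  proof -
    have "(l \<otimes>\<^bsub>G\<^esub> l') \<otimes>\<^bsub>G\<^esub> g [^]\<^bsub>G\<^esub> (i + j) = (l \<otimes>\<^bsub>G\<^esub> g [^]\<^bsub>G\<^esub> i) \<otimes>\<^bsub>G\<^esub> (l' \<otimes>\<^bsub>G\<^esub> g [^]\<^bsub>G\<^esub> j)"
      using that(1,2) g(1) by (simp add: G.m_ac flip: G.nat_pow_mult)
    then show ?thesis using subgroup.m_closed[OF H(1) that(3,4)] by simp
  qed
  have HL: "H \<subseteq> L"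
    using HG by (auto simp: L_def intro!: exI[of _ "0::nat"])
  have gL: "g \<in> L"
  proof -
    have "g \<otimes>\<^bsub>G\<^esub> g [^]\<^bsub>G\<^esub> (G.ord g - 1) = \<one>\<^bsub>G\<^esub>"
      using g(1,2) G.nat_pow_Suc2[of g "G.ord g - 1"] G.pow_ord_eq_1[OF g(1)] by simp
    then have "g \<otimes>\<^bsub>G\<^esub> g [^]\<^bsub>G\<^esub> (G.ord g - 1) \<in> H"
      using subgroup.one_closed[OF H(1)] by simp
    then show ?thesis using g(1) unfolding L_def by blast
  qed
  have L: "subgroup L G"
  proof (rule G.subgroupI)
    show "L \<subseteq> carrier G" by (auto simp: L_def)
    show "L \<noteq> {}" using gL by blast
    show "l \<otimes>\<^bsub>G\<^esub> l' \<in> L" if "l \<in> L" "l' \<in> L" for l l'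
      using that prod unfolding L_def by blast
    show "inv\<^bsub>G\<^esub> l \<in> L" if "l \<in> L" for l
    proof -
      obtain i :: nat where l: "l \<in> carrier G" and i: "l \<otimes>\<^bsub>G\<^esub> g [^]\<^bsub>G\<^esub> i \<in> H"
        using \<open>l \<in> L\<close> by (auto simp: L_def)
      \<comment> \<open>Since \<open>(k + 1) i\<close> is a multiple of the order of \<open>g\<close>, the inverse of \<open>g\<^sup>i\<close> is \<open>g\<^sup>k\<^sup>i\<close>.\<close>
      obtain k where k: "G.ord g = Suc k" using g(2) by (cases "G.ord g") auto
      have "g [^]\<^bsub>G\<^esub> i \<otimes>\<^bsub>G\<^esub> g [^]\<^bsub>G\<^esub> (k * i) = (g [^]\<^bsub>G\<^esub> Suc k) [^]\<^bsub>G\<^esub> i"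
        using g(1) by (simp only: G.nat_pow_mult G.nat_pow_pow mult_Suc)
      also have "\<dots> = \<one>\<^bsub>G\<^esub>" using G.pow_ord_eq_1[OF g(1)] by (simp only: k G.nat_pow_one)
      finally have "g [^]\<^bsub>G\<^esub> (k * i) = inv\<^bsub>G\<^esub> (g [^]\<^bsub>G\<^esub> i)"
        using g(1) G.inv_equality[of "g [^]\<^bsub>G\<^esub> (k * i)" "g [^]\<^bsub>G\<^esub> i"] by (simp add: G.m_comm)
      then have "inv\<^bsub>G\<^esub> l \<otimes>\<^bsub>G\<^esub> g [^]\<^bsub>G\<^esub> (k * i) = inv\<^bsub>G\<^esub> (l \<otimes>\<^bsub>G\<^esub> g [^]\<^bsub>G\<^esub> i)"
        using l g(1) by (simp add: G.inv_mult)
      then show ?thesis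
        using subgroup.m_inv_closed[OF H(1) i] l by (auto simp: L_def intro!: exI[of _ "k * i"])
    qed
  qed
  have "nilpotents_traceless_on L"
  proof (rule nilpotents_traceless_on_extend[OF assms(3) H(2) _ HL L _ _ _ _ m_inv])
    show one: "\<one>\<^bsub>G\<^esub> \<in> H" using H(1) by (rule subgroup.one_closed)
    show "\<chi> \<in> L \<rightarrow> carrier K" using z(1) by (auto simp: \<chi>_def)
    show "\<chi> \<one>\<^bsub>G\<^esub> = \<one>\<^bsub>K\<^esub>" using \<chi>_eq[of "\<one>\<^bsub>G\<^esub>" 0] one by simp
    show "\<chi> (l \<otimes>\<^bsub>G\<^esub> l') = \<chi> l \<otimes>\<^bsub>K\<^esub> \<chi> l'" if ll: "l \<in> L" "l' \<in> L" for l l'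
    proof -
      obtain i j :: nat where ij: "l \<in> carrier G" "l' \<in> carrier G" "l \<otimes>\<^bsub>G\<^esub> g [^]\<^bsub>G\<^esub> i \<in> H" "l' \<otimes>\<^bsub>G\<^esub> g [^]\<^bsub>G\<^esub> j \<in> H"
        using ll by (auto simp: L_def)
      then have "\<chi> (l \<otimes>\<^bsub>G\<^esub> l') = z [^]\<^bsub>K\<^esub> (i + j)" "\<chi> l = z [^]\<^bsub>K\<^esub> i" "\<chi> l' = z [^]\<^bsub>K\<^esub> j"
        using \<chi>_eq prod by auto
      then show ?thesis using z(1) by (simp add: K.nat_pow_mult)
    qed
    show "(\<Oplus>\<^bsub>K\<^esub>k\<in>{..<m}. \<chi> l [^]\<^bsub>K\<^esub> k) = (if l \<in> H then [m] \<cdot>\<^bsub>K\<^esub> \<one>\<^bsub>K\<^esub> else \<zero>\<^bsub>K\<^esub>)" if lL: "l \<in> L" for l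
    proof -
      obtain i :: nat where l: "l \<in> carrier G" and i: "l \<otimes>\<^bsub>G\<^esub> g [^]\<^bsub>G\<^esub> i \<in> H"
        using lL by (auto simp: L_def)
      have "l \<in> H \<longleftrightarrow> g [^]\<^bsub>G\<^esub> i \<in> H"
      proof
        assume "l \<in> H"
        then show "g [^]\<^bsub>G\<^esub> i \<in> H" using G.subgroup_left_cancel[OF H(1) _ _ i] g(1) by simp
      next
        assume "g [^]\<^bsub>G\<^esub> i \<in> H"
        then show "l \<in> H"
          using G.subgroup_left_cancel[OF H(1), of "g [^]\<^bsub>G\<^esub> i" l] i l g(1) by (simp add: G.m_comm)
      qed
      then show ?thesis
        using K.root_of_unity_power_sum[OF z, of i] \<chi>_eq[OF l i] m(2) by simp
    qed
  qed
  then show thesis using that L HL gL by blast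
qed

text \<open>
  Zorn's lemma: the property passes to unions of chains because elements have finite support, and a
  maximal subgroup with the property is everything because any element can be adjoined.
\<close>
lemma nilpotents_traceless:
  assumes "algebraically_closed K" "comm_group G" "cring A"
    and ord: "\<And>g. g \<in> carrier G \<Longrightarrow> G.ord g > 0"
      "\<And>g. g \<in> carrier G \<Longrightarrow> [G.ord g] \<cdot>\<^bsub>K\<^esub> \<one>\<^bsub>K\<^esub> \<noteq> \<zero>\<^bsub>K\<^esub>"
  shows "nilpotents_traceless_on (carrier G)"
proof -
  define \<H> where "\<H> = {H. subgroup H G \<and> nilpotents_traceless_on H}"
  have "\<exists>M\<in>\<H>. \<forall>N\<in>\<H>. M \<subseteq> N \<longrightarrow> N = M"
  proof (rule subset_Zorn_nonempty)
    show "\<H> \<noteq> {}"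
      using G.triv_subgroup nilpotents_traceless_on_trivial by (auto simp: \<H>_def)
    show "\<Union>C \<in> \<H>" if "C \<noteq> {}" and chain: "subset.chain \<H> C" for C
    proof -
      have C: "subgroup H G" "nilpotents_traceless_on H" if "H \<in> C" for H
        using that chain by (auto simp: \<H>_def subset.chain_def)
      have total: "H \<subseteq> H' \<or> H' \<subseteq> H" if "H \<in> C" "H' \<in> C" for H H'
        using that chain by (auto simp: subset.chain_def)
      have "nilpotents_traceless_on (\<Union>C)"
        unfolding nilpotents_traceless_on_def
      proof (intro allI impI, elim conjE)
        fix F c
        assume F: "finite F" "F \<subseteq> \<Union>C" "\<one>\<^bsub>G\<^esub> \<in> F" "c \<in> F \<rightarrow> carrier K"
          "nilpotent_element A (\<Oplus>\<^bsub>A\<^esub>g\<in>F. c g \<odot>\<^bsub>A\<^esub> u g)"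
        obtain H where "H \<in> C" "F \<subseteq> H"
          using finite_subset_Union_chain[OF F(1,2) \<open>C \<noteq> {}\<close> chain] by blast
        then show "c \<one>\<^bsub>G\<^esub> = \<zero>\<^bsub>K\<^esub>"
          using C(2) F unfolding nilpotents_traceless_on_def by blast
      qed
      then show ?thesis
        using G.subgroup_Union_chain[of C] C(1) total \<open>C \<noteq> {}\<close> by (simp add: \<H>_def)
    qed
  qed
  then obtain M where M: "subgroup M G" "nilpotents_traceless_on M"
    and maximal: "\<And>N. subgroup N G \<Longrightarrow> nilpotents_traceless_on N \<Longrightarrow> M \<subseteq> N \<Longrightarrow> N = M"
    by (auto simp: \<H>_def)
  have "carrier G \<subseteq> M"
  proof
    fix g assume g: "g \<in> carrier G"
    obtain L where "subgroup L G" "M \<subseteq> L" "g \<in> L" "nilpotents_traceless_on L"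
      using nilpotents_traceless_on_adjoin[OF assms(1-3) M g ord(1)[OF g] ord(2)[OF g]] by blast
    then show "g \<in> M" using maximal by blast
  qed
  then have "M = carrier G" using subgroup.subset[OF M(1)] by blast
  then show ?thesis using M(2) by simp
qed

text \<open>
  The coefficient of \<open>x\<close> at \<open>g\<close> is, up to a nonzero factor, the coefficient at \<open>\<one>\<close> of \<open>x\<close> times the basis
  element of the inverse of \<open>g\<close>, which is nilpotent along with \<open>x\<close>.
\<close>
lemma nilpotent_imp_zero:
  assumes "cring A" "nilpotents_traceless_on (carrier G)" "nilpotent_element A x"
  shows "x = \<zero>\<^bsub>A\<^esub>"
proof -
  interpret A: cring A by fact
  have "x \<in> carrier A" using assms(3) by (simp add: nilpotent_element_def)
  then obtain F c where Fc: "finite F" "F \<subseteq> carrier G" "c \<in> F \<rightarrow> carrier K"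
    and x: "x = (\<Oplus>\<^bsub>A\<^esub>g\<in>F. c g \<odot>\<^bsub>A\<^esub> u g)"
    using basis unfolding basis_family_def spanning_family_def by blast
  have gF: "f \<in> carrier G" "c f \<in> carrier K" if "f \<in> F" for f using that Fc by auto
  have "c g = \<zero>\<^bsub>K\<^esub>" if g: "g \<in> F" for g
  proof -
    let ?h = "inv\<^bsub>G\<^esub> g" and ?s = "\<lambda>f. f \<otimes>\<^bsub>G\<^esub> inv\<^bsub>G\<^esub> g"
    have h: "?h \<in> carrier G" using gF g by simp
    define c' where "c' k = c (k \<otimes>\<^bsub>G\<^esub> g) \<otimes>\<^bsub>K\<^esub> \<rho> (k \<otimes>\<^bsub>G\<^esub> g) ?h" for k
    have c': "c' (?s f) = c f \<otimes>\<^bsub>K\<^esub> \<rho> f ?h" if "f \<in> F" for f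
      using gF[OF that] gF[OF g] by (simp add: c'_def G.m_assoc)
    have inj: "inj_on ?s F" using gF g by (auto intro!: inj_onI)
    have "x \<otimes>\<^bsub>A\<^esub> u ?h = (\<Oplus>\<^bsub>A\<^esub>f\<in>F. (c f \<odot>\<^bsub>A\<^esub> u f) \<otimes>\<^bsub>A\<^esub> u ?h)"
      unfolding x using Fc(1) gF h by (intro A.finsum_ldistr) auto
    also have "\<dots> = (\<Oplus>\<^bsub>A\<^esub>f\<in>F. c' (?s f) \<odot>\<^bsub>A\<^esub> u (?s f))"
      using gF h c' by (intro M.finsum_cong') (auto simp: smult_mult_left basis_mult smult_assoc1)
    also have "\<dots> = (\<Oplus>\<^bsub>A\<^esub>k\<in>?s ` F. c' k \<odot>\<^bsub>A\<^esub> u k)"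
      using gF h c' inj by (intro M.finsum_reindex[symmetric]) auto
    finally have "nilpotent_element A (\<Oplus>\<^bsub>A\<^esub>k\<in>?s ` F. c' k \<odot>\<^bsub>A\<^esub> u k)"
      using A.nilpotent_mult[OF assms(3), of "u ?h"] h by simp
    moreover have "finite (?s ` F)" "?s ` F \<subseteq> carrier G" "c' \<in> ?s ` F \<rightarrow> carrier K"
      using Fc(1) gF h c' by auto
    moreover have "?s g = \<one>\<^bsub>G\<^esub>" using gF g by simp
    moreover have "\<one>\<^bsub>G\<^esub> \<in> ?s ` F" using g calculation(5) by (metis image_eqI)
    ultimately have "c' (?s g) = \<zero>\<^bsub>K\<^esub>"
      using assms(2) unfolding nilpotents_traceless_on_def by metis
    then have "c g \<otimes>\<^bsub>K\<^esub> \<rho> g ?h = \<zero>\<^bsub>K\<^esub>" using c'[OF g] by simp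
    then show ?thesis
      using K.integral[of "c g" "\<rho> g ?h"] gF(2)[OF g] factor_nonzero[OF gF(1)[OF g] h] by blast
  qed
  then have "x = (\<Oplus>\<^bsub>A\<^esub>g\<in>F. \<zero>\<^bsub>A\<^esub>)"
    unfolding x using gF by (intro M.finsum_cong') auto
  then show ?thesis by simp
qed

end

theorem theorem1:
  fixes K :: "('k, 'm) ring_scheme"
    and G :: "('g, 'n) monoid_scheme"
    and \<rho> :: "'g \<Rightarrow> 'g \<Rightarrow> 'k"
    and A :: "('k, 'a, 'p) module_scheme"
    and u :: "'g \<Rightarrow> 'a"
  assumes "algebraically_closed K"
    and "torsion_group G"
    and "twisted_group_algebra K G \<rho> A u"
  shows "\<not> (\<exists>x\<in>carrier A. x \<noteq> \<zero>\<^bsub>A\<^esub> \<and> nilpotent_element A x) \<longleftrightarrow>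
    comm_group G \<and>
    (\<forall>g\<in>carrier G. [group.ord G g] \<cdot>\<^bsub>K\<^esub> \<one>\<^bsub>K\<^esub> \<noteq> \<zero>\<^bsub>K\<^esub>) \<and>
    symmetric_factor_system G \<rho>"
proof -
  interpret twisted_group_algebra K G \<rho> A u by fact
  have ord: "G.ord g > 0" if g: "g \<in> carrier G" for g
  proof -
    obtain n :: nat where "n > 0" "g [^]\<^bsub>G\<^esub> n = \<one>\<^bsub>G\<^esub>"
      using assms(2) g by (auto simp: torsion_group_def)
    then show ?thesis using G.pow_eq_id[OF g, of n] by (auto intro: dvd_pos_nat)
  qed
  show ?thesis
  proof (intro iffI)
    assume no_nilpotents: "\<not> (\<exists>x\<in>carrier A. x \<noteq> \<zero>\<^bsub>A\<^esub> \<and> nilpotent_element A x)"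
    have reduced: "reduced_ring A"
      unfolding reduced_ring_def
    proof (intro ballI impI)
      fix x assume x: "x \<in> carrier A" "x \<otimes>\<^bsub>A\<^esub> x = \<zero>\<^bsub>A\<^esub>"
      then have "x [^]\<^bsub>A\<^esub> (2::nat) = \<zero>\<^bsub>A\<^esub>" by (simp add: numeral_2_eq_2)
      then have "nilpotent_element A x"
        using x(1) unfolding nilpotent_element_def by (intro conjI exI[of _ "2::nat"]) auto
      then show "x = \<zero>\<^bsub>A\<^esub>" using no_nilpotents x(1) by blast
    qed
    have commute: "u g \<otimes>\<^bsub>A\<^esub> u h = u h \<otimes>\<^bsub>A\<^esub> u g" if "g \<in> carrier G" "h \<in> carrier G" for g h
      using reduced_imp_basis_commute[OF assms(1) reduced that(1) ord[OF that(1)]] that(2) by simp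
    have "comm_group G"
      using basis_commuteD(1)[OF _ _ commute] by (intro G.group_comm_groupI)
    moreover have "symmetric_factor_system G \<rho>"
      using basis_commuteD(2)[OF _ _ commute] by (simp add: symmetric_factor_system_def)
    ultimately show "comm_group G \<and>
        (\<forall>g\<in>carrier G. [group.ord G g] \<cdot>\<^bsub>K\<^esub> \<one>\<^bsub>K\<^esub> \<noteq> \<zero>\<^bsub>K\<^esub>) \<and> symmetric_factor_system G \<rho>"
      using reduced_imp_ord_invertible[OF assms(1) reduced _ ord] by blast
  next
    assume "comm_group G \<and>
        (\<forall>g\<in>carrier G. [group.ord G g] \<cdot>\<^bsub>K\<^esub> \<one>\<^bsub>K\<^esub> \<noteq> \<zero>\<^bsub>K\<^esub>) \<and> symmetric_factor_system G \<rho>"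
    then have comm: "comm_group G" and sym: "symmetric_factor_system G \<rho>"
      and inv: "\<And>g. g \<in> carrier G \<Longrightarrow> [G.ord g] \<cdot>\<^bsub>K\<^esub> \<one>\<^bsub>K\<^esub> \<noteq> \<zero>\<^bsub>K\<^esub>" by blast+
    have A: "cring A" using comm sym by (rule commutative_algebra)
    have "nilpotents_traceless_on (carrier G)"
      using assms(1) comm A ord inv by (rule nilpotents_traceless)
    then show "\<not> (\<exists>x\<in>carrier A. x \<noteq> \<zero>\<^bsub>A\<^esub> \<and> nilpotent_element A x)"
      using nilpotent_imp_zero[OF A] by blast
  qed
qed

end
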